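(* Let $l,m,n$ be integers with $m,n\ge1$ and $l\ge m+n$. If $l$ is even, then for each $d\in\{m,n\}$, $$\sum_{\substack{l_1\ge m+1,\ l_2,\ldots,l_n\ge1\\ l_1+\cdots+l_n=l}}\zeta(l_1,\ldots,l_n)\equiv0\pmod{\mathcal{Z}_l^{(d+1)}+\mathcal{P}_l}.$$ In particular, if $l$ is even and moreover $m+1<n$, then the left-hand side is congruent to $0$ modulo $\mathcal{Z}_l^{(<n)}+\mathcal{P}_l$.
   Context: Multiple zeta values (MZVs): for positive integers $l_1,\ldots,l_n$ with $n\ge1$, $l_1\ge2$, $\zeta(l_1,\ldots,l_n)=\sum_{m_1>\cdots>m_n>0}\frac{1}{m_1^{l_1}\cdots m_n^{l_n}}$; its weight is $l_1+\cdots+l_n$ and its depth is $n$. Vector spaces (all $\mathbb{Q}$-subspaces of $\mathbb{R}$): $\mathcal{Z}_l^{(d)}$ is the $\mathbb{Q}$-span of all MZVs of weight $l$ and depth $d$ (the zero space if there are none); $\mathcal{Z}_l^{(<n)}=\sum_{d=1}^{n-1}\mathcal{Z}_l^{(d)}$; $\mathcal{P}_l$ is the $\mathbb{Q}$-span of all products of two or more MZVs of total weight $l$ together with the single zeta value $\zeta(l)$ (when $l\ge2$). For a subspace $V$, $a\equiv b\pmod V$ means $a-b\in V$. *)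

theory Defs
  imports "HOL-Analysis.Analysis" "HOL-Library.Set_Algebras"
begin

text \<open>
  An index \<open>(l\<^sub>1, \<dots>, l\<^sub>n)\<close> is the list \<open>[l\<^sub>1, \<dots>, l\<^sub>n]\<close>; its weight is \<open>sum_list\<close> and its depth
  is \<open>length\<close>. Sums of sets, binary and indexed, are the elementwise ones of
  \<^theory>\<open>HOL-Library.Set_Algebras\<close>, where \<open>0\<close> is the singleton \<open>{0}\<close>.
\<close>

definition admissible :: "nat list \<Rightarrow> bool" where
  "admissible ls \<longleftrightarrow> ls \<noteq> [] \<and> hd ls \<ge> 2 \<and> (\<forall>k\<in>set ls. k \<ge> 1)"

text \<open>The terms are positive, so summing over an unordered set of index tuples loses nothing; the
  series converges whenever \<open>ls\<close> is admissible, and \<open>mzv\<close> is only used there.\<close>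
definition mzv :: "nat list \<Rightarrow> real" where
  "mzv ls = (\<Sum>\<^sub>\<infinity>ms\<in>{ms. length ms = length ls \<and> sorted_wrt (>) ms \<and> (\<forall>k\<in>set ms. k > 0)}.
     1 / (\<Prod>i<length ls. real (ms ! i) ^ (ls ! i)))"

global_interpretation rat_real: vector_space "\<lambda>(q::rat) (x::real). of_rat q * x"
  by unfold_locales (simp_all add: algebra_simps of_rat_add of_rat_mult)

definition mzv_depth_space :: "nat \<Rightarrow> nat \<Rightarrow> real set" where
  "mzv_depth_space l d =
     rat_real.span {mzv ls | ls. admissible ls \<and> sum_list ls = l \<and> length ls = d}"

definition mzv_depth_less_space :: "nat \<Rightarrow> nat \<Rightarrow> real set" where
  "mzv_depth_less_space l n = (\<Sum>d\<in>{1..<n}. mzv_depth_space l d)"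

definition mzv_product_space :: "nat \<Rightarrow> real set" where
  "mzv_product_space l =
     rat_real.span
       ({prod_list (map mzv lss) | lss.
           length lss \<ge> 2 \<and> (\<forall>ls\<in>set lss. admissible ls) \<and> sum_list (map sum_list lss) = l}
        \<union> (if l \<ge> 2 then {mzv [l]} else {}))"

definition cong_modulo :: "real \<Rightarrow> real \<Rightarrow> real set \<Rightarrow> bool" where
  "cong_modulo a b V \<longleftrightarrow> a - b \<in> V"

definition sum_indices :: "nat \<Rightarrow> nat \<Rightarrow> nat \<Rightarrow> nat list set" where
  "sum_indices l m n =
     {ls. length ls = n \<and> hd ls \<ge> m + 1 \<and> (\<forall>k\<in>set ls. k \<ge> 1) \<and> sum_list ls = l}"

lemma finite_sum_indices: "finite (sum_indices l m n)"
proof (rule finite_subset)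
  show "sum_indices l m n \<subseteq> {ls. set ls \<subseteq> {..l} \<and> length ls = n}"
    by (auto simp: sum_indices_def member_le_sum_list)
  show "finite {ls. set ls \<subseteq> {..l} \<and> length ls = n}"
    by (rule finite_lists_length_eq) simp
qed

end

theory Submission
  imports Defs
begin

text \<open>
  Write \<open>p = l - m - n + 1\<close> and let \<open>F(m, n, p)\<close> be the sum in question, so that
  \<open>l = m + n + p - 1\<close>.

  \<^emph>\<open>Depth \<open>n + 1\<close>, \<open>p \<ge> 2\<close>.\<close> Let a polynomial in \<open>x\<^sub>1, \<dots>, x\<^sub>n\<close> act on formal combinations of indices of
  depth \<open>n\<close>, the variable \<open>x\<^sub>i\<close> raising the \<open>i\<close>-th entry by one. Then \<open>F(m, n, p)\<close> comes from the
  complete homogeneous polynomial \<open>h\<^bsub>p-1\<^esub>\<close> acting on \<open>(m + 1, 1, \<dots>, 1)\<close>. By Newton's identity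
  \<open>(p - 1) h\<^bsub>p-1\<^esub> = \<Sum>\<^bsub>k\<ge>1\<^esub> p\<^sub>k h\<^bsub>p-1-k\<^esub>\<close> (\<open>sum_indices_excess\<close>) it suffices that every power sum \<open>p\<^sub>k\<close>
  sends an admissible index of depth \<open>n\<close> into \<open>Z\<^bsup>(n+1)\<^esup> + P\<close> (\<open>sum_merges_in_space\<close>). For \<open>k \<ge> 2\<close> this is the stuffle
  product of \<open>\<zeta>(k)\<close> with the index: the terms of depth \<open>n\<close> are the action of \<open>p\<^sub>k\<close>, all others have
  depth \<open>n + 1\<close>. For \<open>k = 1\<close> it is Hoffman's relation, whose other side has depth \<open>n + 1\<close>.

  \<^emph>\<open>The case \<open>p = 1\<close>.\<close> Here \<open>F = \<zeta>(m + 1, 1, \<dots>, 1)\<close>, a value of height one, and it lies in \<open>P\<close>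
  (\<open>height_one_in_product_space\<close>): the generating function \<open>B(a, b)\<close> of these values satisfies
  \<open>1 - B = \<Gamma>(1-a) \<Gamma>(1-b) / \<Gamma>(1-a-b)\<close>, and the logarithmic derivative in \<open>a\<close> is a difference of digamma
  values, whose expansion has rational multiples of single zeta values as coefficients. Comparing
  coefficients in \<open>\<partial>B/\<partial>a = (1 - B) (\<psi>(1-a) - \<psi>(1-a-b))\<close> expresses a multiple of each value
  by single zeta values and products.

  \<^emph>\<open>Depth \<open>m + 1\<close>.\<close> This follows from depth \<open>n + 1\<close> because \<open>F(m, n, p) = F(n, m, p)\<close>
  (\<open>restricted_sum_commute\<close>). For fixed \<open>p\<close>, summing over the depth turns the truncated sums into
  \<open>\<Sum>\<^sub>i (1-b)\<^sub>i (b)\<^bsub>M-i\<^esub> / (i! (M-i)! (i+1)\<^sup>p)\<close>, and summing the beta series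
  \<open>\<Sum>\<^sub>j (b)\<^sub>j / (j! (j + x)) = B(x, 1 - b)\<close> then gives
  \<open>\<Sum>\<^sub>i \<Gamma>(i+1-a) \<Gamma>(i+1-b) / (i! \<Gamma>(i+2-a-b) (i+1)\<^sup>p)\<close> as the generating function in \<open>a\<close> and \<open>b\<close>,
  which is visibly symmetric. If \<open>m + 1 < n\<close>, then \<open>m + 1\<close> is one of the depths below \<open>n\<close>.
\<close>

section \<open>Truncated multiple zeta values and their product relations\<close>

text \<open>Including \<open>k = 0\<close> is harmless: for positive exponents this term vanishes since \<open>x / 0 = 0\<close>.\<close>
primrec tmzv :: "nat list \<Rightarrow> nat \<Rightarrow> real" where
  "tmzv [] N = 1"
| "tmzv (l # ls) N = (\<Sum>k<N. tmzv ls k / real k ^ l)"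

primrec inserts :: "nat \<Rightarrow> nat list \<Rightarrow> nat list list" where
  "inserts k [] = [[k]]"
| "inserts k (l # ls) = (k # l # ls) # map (Cons l) (inserts k ls)"

text \<open>The action of the power sum \<open>x\<^sub>1\<^sup>k + \<dots> + x\<^sub>n\<^sup>k\<close> on an index, when \<open>x\<^sub>i\<close> raises the \<open>i\<close>-th
  entry by one.\<close>
primrec merges :: "nat \<Rightarrow> nat list \<Rightarrow> nat list list" where
  "merges k [] = []"
| "merges k (l # ls) = ((k + l) # ls) # map (Cons l) (merges k ls)"

text \<open>The side of higher depth in Hoffman's relation: an entry \<open>l\<close> is split as
  \<open>(l - j, j + 1)\<close>, which raises both weight and depth by one.\<close>
primrec splits :: "nat list \<Rightarrow> nat list list" where
  "splits [] = []"
| "splits (l # ls) = map (\<lambda>j. (l - j) # (j + 1) # ls) [0..<l - 1] @ map (Cons l) (splits ls)"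

lemma tmzv_sum_map_Cons:
  "(\<Sum>x\<leftarrow>xss. tmzv (l # x) N) = (\<Sum>k<N. (\<Sum>x\<leftarrow>xss. tmzv x k) / real k ^ l)"
  by (induction xss) (simp_all add: sum.distrib add_divide_distrib)

lemma sum_less_mult_sum_less:
  fixes f g :: "nat \<Rightarrow> real"
  shows "(\<Sum>i<N. f i) * (\<Sum>j<N. g j) =
    (\<Sum>i<N. f i * (\<Sum>j<i. g j)) + (\<Sum>j<N. g j * (\<Sum>i<j. f i)) + (\<Sum>i<N. f i * g i)"
  by (induction N) (simp_all add: algebra_simps)

text \<open>The new summation variable is either distinct from all the old ones, and then takes its place
  in their order, or equal to exactly one of them.\<close>
lemma tmzv_stuffle:
  "tmzv [k] N * tmzv ls N = (\<Sum>x\<leftarrow>inserts k ls. tmzv x N) + (\<Sum>x\<leftarrow>merges k ls. tmzv x N)"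
proof (induction ls arbitrary: N)
  case Nil
  show ?case by simp
next
  case (Cons l ls)
  have "tmzv [k] N * tmzv (l # ls) N =
      (\<Sum>i<N. 1 / real i ^ k * tmzv (l # ls) i) +
      (\<Sum>j<N. tmzv ls j / real j ^ l * tmzv [k] j) +
      (\<Sum>i<N. 1 / real i ^ k * (tmzv ls i / real i ^ l))"
    by (simp add: sum_less_mult_sum_less)
  also have "(\<Sum>j<N. tmzv ls j / real j ^ l * tmzv [k] j) =
      (\<Sum>j<N. ((\<Sum>x\<leftarrow>inserts k ls. tmzv x j) + (\<Sum>x\<leftarrow>merges k ls. tmzv x j)) / real j ^ l)"
    unfolding Cons.IH[symmetric] by (simp add: mult.commute)
  finally show ?case
    using tmzv_sum_map_Cons[of l N "inserts k ls"] tmzv_sum_map_Cons[of l N "merges k ls"]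
    by (simp add: o_def sum.distrib add_divide_distrib power_add)
qed

lemma sum_triangle_swap:
  fixes f :: "nat \<Rightarrow> nat \<Rightarrow> real"
  shows "(\<Sum>i<N. \<Sum>j<i. f i j) = (\<Sum>j<N. \<Sum>i\<in>{j<..<N}. f i j)"
proof (induction N)
  case (Suc N)
  have "{j<..<Suc N} = insert N {j<..<N}" if "j < N" for j using that by auto
  moreover have "{N<..<Suc N} = {}" by auto
  ultimately show ?case
    using Suc by (simp add: sum.distrib)
qed simp

lemma sum_inverse_reflect:
  "(\<Sum>q\<in>{r<..<n}. 1 / (real n - real q)) = harm (n - 1 - r)"
proof -
  have "(\<Sum>q\<in>{r<..<n}. 1 / (real n - real q)) = (\<Sum>k\<in>{1..n - 1 - r}. inverse (real k))"
    by (rule sum.reindex_bij_witness[of _ "\<lambda>k. n - k" "\<lambda>q. n - q"])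
       (auto simp: of_nat_diff field_simps)
  then show ?thesis by (simp add: harm_def)
qed

text \<open>The defect of Hoffman's relation at the cutoff \<open>N\<close>. It comes from replacing
  \<open>\<Sum>\<^bsub>M>q\<^esub> (1/(M-q) - 1/M) = H\<^sub>q\<close> by its part \<open>M < N\<close>, which is \<open>H\<^bsub>N-1-q\<^esub> - H\<^bsub>N-1\<^esub> + H\<^sub>q\<close>.\<close>
primrec hoffman_remainder :: "nat list \<Rightarrow> nat \<Rightarrow> real" where
  "hoffman_remainder [] N = 0"
| "hoffman_remainder (l # ls) N = (\<Sum>q<N. tmzv ls q / real q ^ l * (harm (N - 1 - q) - harm (N - 1)))"

lemma sum_tmzv_over_gap:
  "(\<Sum>q\<in>{0<..<n}. tmzv ls q / (real n - real q)) = hoffman_remainder ls n + harm (n - 1) * tmzv ls n"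
proof (cases ls)
  case Nil
  then show ?thesis using sum_inverse_reflect[where r = 0] by simp
next
  case (Cons l ls')
  have "(\<Sum>q\<in>{0<..<n}. tmzv ls q / (real n - real q)) =
        (\<Sum>q<n. \<Sum>r<q. tmzv ls' r / real r ^ l / (real n - real q))"
    by (rule sum.mono_neutral_cong_left) (auto simp: Cons sum_divide_distrib)
  also have "\<dots> = (\<Sum>r<n. tmzv ls' r / real r ^ l * (\<Sum>q\<in>{r<..<n}. 1 / (real n - real q)))"
    by (simp add: sum_triangle_swap sum_distrib_left)
  also have "\<dots> = (\<Sum>r<n. tmzv ls' r / real r ^ l * harm (n - 1 - r))"
    by (simp add: sum_inverse_reflect)
  finally show ?thesis
    by (simp add: Cons algebra_simps sum_subtractf sum_distrib_left)
qed

text \<open>The geometric sum over all splittings of one exponent. In the first term the smaller variable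
  \<open>q\<close> keeps the full exponent and \<open>n\<close> becomes free, in the second one \<open>q\<close> becomes free; the free
  variable occurs only in linear denominators and can be summed to harmonic numbers.\<close>
lemma split_partial_fractions:
  fixes q n :: real
  assumes "0 < q" "q < n"
  shows "(\<Sum>j<l. 1 / (n ^ (Suc l - j) * q ^ (j + 1))) =
         (1 / (n - q) - 1 / n) / q ^ Suc l - 1 / (n - q) / n ^ Suc l"
proof (induction l)
  case 0
  then show ?case using assms by (simp add: field_simps)
next
  case (Suc l)
  have "(\<Sum>j<Suc l. 1 / (n ^ (Suc (Suc l) - j) * q ^ (j + 1))) =
     (\<Sum>j<l. 1 / (n ^ (Suc l - j) * q ^ (j + 1))) / n + 1 / (n ^ 2 * q ^ Suc l)"
    by (simp add: sum_divide_distrib Suc_diff_le mult_ac power2_eq_square)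
  also have "\<dots> = (1 / (n - q) - 1 / n) / q ^ Suc (Suc l) - 1 / (n - q) / n ^ Suc (Suc l)"
    unfolding Suc.IH using assms by (simp add: divide_simps power2_eq_square) algebra
  finally show ?case .
qed

text \<open>After the partial fraction decomposition, the harmonic numbers that belong to the gap between
  two neighbouring variables cancel between adjacent entries. At each variable \<open>q\<close> there remains
  \<open>H\<^sub>q - H\<^bsub>q-1\<^esub> = 1/q\<close>, which raises the exponent of \<open>q\<close> by one. In the induction on the index the
  cancellation is carried by \<open>hoffman_remainder\<close> of the tail.\<close>
lemma tmzv_splits:
  assumes "\<forall>k\<in>set ls. k \<ge> 1"
  shows "(\<Sum>x\<leftarrow>splits ls. tmzv x N) = (\<Sum>x\<leftarrow>merges 1 ls. tmzv x N) + hoffman_remainder ls N"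
  using assms
proof (induction ls arbitrary: N)
  case Nil
  show ?case by simp
next
  case (Cons l ls)
  have l: "l \<ge> 1" using Cons.prems by simp
  define t where "t = (\<lambda>q. tmzv ls q)"
  have pow: "0 ^ l = (0::real)" using l by simp
  have fin: "(\<Sum>j<l - 1. 1 / (real n ^ (l - j) * real q ^ (j + 1))) =
      (1 / (real n - real q) - 1 / real n) / real q ^ l - 1 / (real n - real q) / real n ^ l"
    if "0 < q" "q < n" for q n
    using split_partial_fractions[of "real q" "real n" "l - 1"] that l by simp
  have distr: "x * ((u - v) / Q - u / R) = x / Q * (u - v) - x * u / R" for x u v Q R :: real
    by (simp add: algebra_simps diff_divide_distrib)
  have "(\<Sum>j<l - 1. tmzv ((l - j) # (j + 1) # ls) N) =
     (\<Sum>n<N. \<Sum>q<n. t q * (\<Sum>j<l - 1. 1 / (real n ^ (l - j) * real q ^ (j + 1))))"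
    unfolding t_def
    by (simp add: sum_distrib_left sum_divide_distrib sum.swap[of _ _ "{..<l - Suc 0}"] mult_ac)
  also have "\<dots> = (\<Sum>n<N. \<Sum>q\<in>{0<..<n}. t q * (\<Sum>j<l - 1. 1 / (real n ^ (l - j) * real q ^ (j + 1))))"
    by (intro sum.cong refl sum.mono_neutral_right) auto
  also have "\<dots> = (\<Sum>n<N. \<Sum>q\<in>{0<..<n}. t q / real q ^ l * (1 / (real n - real q) - 1 / real n)) -
      (\<Sum>n<N. (\<Sum>q\<in>{0<..<n}. t q / (real n - real q)) / real n ^ l)"
    unfolding sum_subtractf[symmetric] sum_divide_distrib
  proof (intro sum.cong refl)
    fix n q :: nat assume "q \<in> {0<..<n}"
    then show "t q * (\<Sum>j<l - 1. 1 / (real n ^ (l - j) * real q ^ (j + 1))) =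
        t q / real q ^ l * (1 / (real n - real q) - 1 / real n) - t q / (real n - real q) / real n ^ l"
      using distr[of "t q" "1 / (real n - real q)" "1 / real n" "real q ^ l" "real n ^ l"]
      by (subst fin) simp_all
  qed
  also have "(\<Sum>n<N. \<Sum>q\<in>{0<..<n}. t q / real q ^ l * (1 / (real n - real q) - 1 / real n)) =
      (\<Sum>n<N. \<Sum>q<n. t q / real q ^ l * (1 / (real n - real q) - 1 / real n))"
    by (intro sum.cong refl sum.mono_neutral_left) (auto simp: pow)
  also have "\<dots> = (\<Sum>q<N. t q / real q ^ l * (\<Sum>n\<in>{q<..<N}. 1 / (real n - real q) - 1 / real n))"
    by (simp add: sum_triangle_swap sum_distrib_left)
  also have "\<dots> = (\<Sum>q<N. t q / real q ^ l * (harm (N - 1 - q) - harm (N - 1) + harm q))"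
  proof (intro sum.cong refl, goal_cases)
    case (1 q)
    have a: "(\<Sum>n\<in>{q<..<N}. 1 / (real n - real q)) = harm (N - 1 - q)"
      unfolding harm_def
      by (rule sum.reindex_bij_witness[of _ "\<lambda>k. k + q" "\<lambda>n. n - q"])
         (auto simp: of_nat_diff field_simps)
    have "{1..N - 1} = {1..q} \<union> {q<..<N}" using 1 by auto
    then have "harm (N - 1) = harm q + (\<Sum>n\<in>{q<..<N}. 1 / real n)"
      unfolding harm_def inverse_eq_divide by (subst sum.union_disjoint[symmetric]) auto
    then show ?case by (simp add: sum_subtractf a)
  qed
  also have "(\<Sum>n<N. (\<Sum>q\<in>{0<..<n}. t q / (real n - real q)) / real n ^ l) =
      (\<Sum>n<N. (hoffman_remainder ls n + harm (n - 1) * t n) / real n ^ l)"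
    unfolding t_def by (simp add: sum_tmzv_over_gap)
  finally have block: "(\<Sum>j<l - 1. tmzv ((l - j) # (j + 1) # ls) N) =
      (\<Sum>q<N. t q / real q ^ l * (harm (N - 1 - q) - harm (N - 1) + harm q)) -
      (\<Sum>n<N. (hoffman_remainder ls n + harm (n - 1) * t n) / real n ^ l)" .
  \<comment> \<open>The surplus \<open>H\<^sub>n - H\<^bsub>n-1\<^esub> = 1/n\<close> that raises the exponent of the first entry.\<close>
  have h: "t n / real n ^ l * harm n - harm (n - 1) * t n / real n ^ l = t n / real n ^ (l + 1)" for n
  proof (cases n)
    case 0
    then show ?thesis using l by simp
  next
    case (Suc n')
    have "x / P * (h + inverse m) - h * x / P = x / (m * P)" for x P h m :: real
      by (simp add: distrib_left inverse_eq_divide mult_ac)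
    then show ?thesis by (simp add: Suc harm_Suc)
  qed
  have h': "(\<Sum>n<N. t n / real n ^ l * harm n) = (\<Sum>n<N. t n / real n ^ (l + 1)) +
      (\<Sum>n<N. harm (n - 1) * t n / real n ^ l)"
    unfolding h[symmetric] by (simp add: sum_subtractf)
  have e: "hoffman_remainder (l # ls) N = (\<Sum>q<N. t q / real q ^ l * (harm (N - 1 - q) - harm (N - 1)))"
    by (simp add: t_def)
  have r: "(\<Sum>j\<leftarrow>[0..<l - 1]. f j) = (\<Sum>j<l - 1. f j)" for f :: "nat \<Rightarrow> real"
    by (simp add: interv_sum_list_conv_sum_set_nat atLeast0LessThan)
  have "(\<Sum>x\<leftarrow>splits (l # ls). tmzv x N) = (\<Sum>j<l - 1. tmzv ((l - j) # (j + 1) # ls) N) +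
      (\<Sum>x\<leftarrow>splits ls. tmzv (l # x) N)"
    using r[of "\<lambda>j. tmzv ((l - j) # (j + 1) # ls) N"] by (simp add: o_def del: tmzv.simps)
  also have "(\<Sum>x\<leftarrow>splits ls. tmzv (l # x) N) =
     (\<Sum>x\<leftarrow>merges 1 ls. tmzv (l # x) N) + (\<Sum>n<N. hoffman_remainder ls n / real n ^ l)"
    using Cons.prems unfolding tmzv_sum_map_Cons
    by (simp add: Cons.IH add_divide_distrib sum.distrib)
  also have "(\<Sum>j<l - 1. tmzv ((l - j) # (j + 1) # ls) N) + \<dots> =
      tmzv ((1 + l) # ls) N + (\<Sum>x\<leftarrow>merges 1 ls. tmzv (l # x) N) + hoffman_remainder (l # ls) N"
    unfolding block e using h'
    by (simp add: distrib_left add_divide_distrib sum.distrib t_def)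
  finally show ?case by (simp add: o_def)
qed

section \<open>Convergence\<close>

lemma tmzv_nonneg: "tmzv ls N \<ge> 0"
  by (induction ls arbitrary: N) (auto intro!: sum_nonneg)

text \<open>Logarithmic growth in a form that makes every power of a harmonic number harmless against
  \<open>1 / n\<^sup>2\<close>.\<close>
lemma harm_le_powr:
  assumes "e > 0" and "n \<ge> 1"
  shows "harm n \<le> (1 + 1 / e) * real n powr e"
proof -
  have "harm n \<le> ln (real n) + 1"
    using euler_mascheroni_sequence_decreasing[of 1 n] assms(2) by (simp add: harm_def)
  also have "ln (real n) \<le> real n powr e / e"
    using assms by (intro ln_powr_bound) auto
  also have "1 \<le> real n powr e"
    using assms by (simp add: ge_one_powr_ge_zero)
  finally show ?thesis using assms by (simp add: algebra_simps)
qed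

lemma summable_harm_power:
  "summable (\<lambda>n. harm n ^ r / real n ^ 2)"
proof -
  \<comment> \<open>Small enough that \<open>(n\<^sup>e)\<^sup>r\<close> grows more slowly than the square root of \<open>n\<close>.\<close>
  define e :: real where "e = 1 / (2 * real (Suc r))"
  have e: "e > 0" "e * real r - 2 < -1" by (auto simp: e_def field_simps)
  have "summable (\<lambda>n. (1 + 1 / e) ^ r * real n powr (e * real r - 2))"
    using e by (intro summable_mult) (simp add: summable_real_powr_iff)
  then show ?thesis
  proof (rule summable_comparison_test')
    fix n :: nat assume n: "n \<ge> 1"
    have "harm n ^ r \<le> ((1 + 1 / e) * real n powr e) ^ r"
      using harm_le_powr[OF e(1) n] by (intro power_mono) (auto simp: harm_nonneg)
    also have "\<dots> = (1 + 1 / e) ^ r * real n powr (e * real r)"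
      using n by (simp add: power_mult_distrib powr_power mult.commute)
    finally have "harm n ^ r / real n ^ 2 \<le> (1 + 1 / e) ^ r * real n powr (e * real r) / real n ^ 2"
      by (simp add: divide_right_mono)
    also have "\<dots> = (1 + 1 / e) ^ r * real n powr (e * real r - 2)"
      using n by (simp add: powr_diff)
    finally show "norm (harm n ^ r / real n ^ 2) \<le> (1 + 1 / e) ^ r * real n powr (e * real r - 2)"
      by (simp add: harm_nonneg)
  qed
qed

lemma tmzv_le_harm_power:
  assumes "\<forall>k\<in>set ls. k \<ge> 1"
  shows "tmzv ls N \<le> harm N ^ length ls"
  using assms
proof (induction ls arbitrary: N)
  case (Cons l ls)
  have "tmzv (l # ls) N \<le> (\<Sum>k<N. harm N ^ length ls * inverse (real k))"
    unfolding tmzv.simps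
  proof (rule sum_mono)
    fix k assume k: "k \<in> {..<N}"
    have "tmzv ls k \<le> harm k ^ length ls" using Cons by simp
    also have "\<dots> \<le> harm N ^ length ls"
      using k by (intro power_mono harm_mono harm_nonneg) auto
    finally have "tmzv ls k \<le> harm N ^ length ls" .
    moreover have "1 / real k ^ l \<le> inverse (real k)"
    proof (cases "k = 0")
      case False
      have "real k ^ 1 \<le> real k ^ l" using False Cons.prems by (intro power_increasing) auto
      then show ?thesis using False by (simp add: field_simps)
    qed (use Cons.prems in \<open>simp add: power_0_left\<close>)
    ultimately have "tmzv ls k * (1 / real k ^ l) \<le> harm N ^ length ls * inverse (real k)"
      by (intro mult_mono) (auto simp: tmzv_nonneg harm_nonneg)
    then show "tmzv ls k / real k ^ l \<le> harm N ^ length ls * inverse (real k)" by simp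
  qed
  also have "\<dots> = harm N ^ length ls * (\<Sum>k<N. inverse (real k))"
    by (simp add: sum_distrib_left)
  also have "\<dots> \<le> harm N ^ length ls * harm N"
  proof (rule mult_left_mono)
    have "(\<Sum>k<N. inverse (real k)) = (\<Sum>k\<in>{0<..<N}. inverse (real k))"
      by (rule sum.mono_neutral_right) auto
    also have "\<dots> \<le> harm N" unfolding harm_def by (rule sum_mono2) auto
    finally show "(\<Sum>k<N. inverse (real k)) \<le> harm N" .
  qed (simp add: harm_nonneg)
  finally show ?case by (simp add: mult.commute)
qed simp

lemma admissible_Cons_iff: "admissible (l # ls) \<longleftrightarrow> l \<ge> 2 \<and> (\<forall>k\<in>set ls. k \<ge> 1)"
  by (auto simp: admissible_def)

lemma summable_tmzv_harm:
  assumes "admissible (l # ls)"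
  shows "summable (\<lambda>n. tmzv ls n * harm n ^ r / real n ^ l)"
proof (rule summable_comparison_test'[OF summable_harm_power[of "length ls + r"], of 1])
  fix n :: nat assume n: "n \<ge> 1"
  have "tmzv ls n \<le> harm n ^ length ls"
    using assms by (intro tmzv_le_harm_power) (auto simp: admissible_Cons_iff)
  moreover have "real n ^ 2 \<le> real n ^ l"
    using assms n by (intro power_increasing) (auto simp: admissible_Cons_iff)
  ultimately have "tmzv ls n * harm n ^ r / real n ^ l \<le> harm n ^ length ls * harm n ^ r / real n ^ 2"
    using n by (intro frac_le mult_mono mult_nonneg_nonneg zero_le_power harm_nonneg) (auto simp: tmzv_nonneg)
  then show "norm (tmzv ls n * harm n ^ r / real n ^ l) \<le> harm n ^ (length ls + r) / real n ^ 2"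
    by (simp add: power_add harm_nonneg tmzv_nonneg)
qed

definition chains :: "nat \<Rightarrow> nat \<Rightarrow> nat list set" where
  "chains r N = {ms. length ms = r \<and> sorted_wrt (>) ms \<and> (\<forall>k\<in>set ms. 0 < k \<and> k < N)}"

lemma finite_chains: "finite (chains r N)"
  by (rule finite_subset[OF _ finite_lists_length_eq[of "{..<N}" r]]) (auto simp: chains_def)

lemma chains_0: "chains 0 N = {[]}"
  by (auto simp: chains_def)

lemma bij_betw_chains_Suc:
  "bij_betw (\<lambda>(k, ms). k # ms) (Sigma {0<..<N} (chains r)) (chains (Suc r) N)"
  by (rule bij_betwI[of _ _ _ "\<lambda>ms. (hd ms, tl ms)"])
     (fastforce simp: chains_def length_Suc_conv)+

lemma tmzv_eq_sum_chains:
  assumes "\<forall>k\<in>set ls. k \<ge> 1"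
  shows "tmzv ls N = (\<Sum>ms\<in>chains (length ls) N. 1 / (\<Prod>i<length ls. real (ms ! i) ^ (ls ! i)))"
  using assms
proof (induction ls arbitrary: N)
  case Nil
  then show ?case by (simp add: chains_0)
next
  case (Cons l ls)
  have "tmzv (l # ls) N = (\<Sum>k\<in>{0<..<N}. tmzv ls k / real k ^ l)"
    unfolding tmzv.simps using Cons.prems by (intro sum.mono_neutral_right) auto
  also have "\<dots> = (\<Sum>(k, ms)\<in>Sigma {0<..<N} (chains (length ls)).
      1 / (\<Prod>i<length (l # ls). real ((k # ms) ! i) ^ ((l # ls) ! i)))"
    using Cons
    by (subst sum.Sigma[symmetric])
       (auto simp: finite_chains sum_divide_distrib prod.lessThan_Suc_shift mult.commute
             simp del: prod.lessThan_Suc intro!: sum.cong)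
  also have "\<dots> = (\<Sum>ms\<in>chains (length (l # ls)) N.
      1 / (\<Prod>i<length (l # ls). real (ms ! i) ^ ((l # ls) ! i)))"
    using sum.reindex_bij_betw[OF bij_betw_chains_Suc[of N "length ls"],
        of "\<lambda>ms. 1 / (\<Prod>i<length (l # ls). real (ms ! i) ^ ((l # ls) ! i))"]
    by (simp add: case_prod_unfold)
  finally show ?case .
qed

text \<open>Summing over the largest variable last turns the unordered sum over tuples into an ordinary
  series of truncated values.\<close>
lemma mzv_sums:
  assumes "admissible (l # ls)"
  shows "(\<lambda>n. tmzv ls n / real n ^ l) sums mzv (l # ls)"
proof -
  define A where "A = {ms. length ms = length (l # ls) \<and> sorted_wrt (>) ms \<and> (\<forall>k\<in>set ms. (k::nat) > 0)}"
  define t where "t = (\<lambda>ms. 1 / (\<Prod>i<length (l # ls). real (ms ! i) ^ ((l # ls) ! i)))"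
  have l: "l \<ge> 2" "\<forall>k\<in>set ls. k \<ge> 1" using assms by (auto simp: admissible_Cons_iff)
  have sm: "summable (\<lambda>n. tmzv ls n / real n ^ l)"
    using summable_tmzv_harm[OF assms, of 0] by simp
  have *: "((\<lambda>n. tmzv ls n / real n ^ l) has_sum (\<Sum>n. tmzv ls n / real n ^ l)) {0<..}"
    using sums_nonneg_imp_has_sum[OF summable_sums[OF sm]] l
    by (subst has_sum_cong_neutral[where T = UNIV]) (auto simp: tmzv_nonneg)
  have inner: "((\<lambda>ms. t (k # ms)) has_sum (tmzv ls k / real k ^ l)) (chains (length ls) k)" for k
  proof -
    have "tmzv ls k / real k ^ l = (\<Sum>ms\<in>chains (length ls) k. t (k # ms))"
      using l by (simp add: tmzv_eq_sum_chains t_def prod.lessThan_Suc_shift sum_divide_distrib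
          mult.commute del: prod.lessThan_Suc)
    then show ?thesis by (simp add: has_sum_finite_iff finite_chains)
  qed
  have "(\<lambda>(k, ms). t (k # ms)) summable_on Sigma {0<..} (chains (length ls))"
    by (rule summable_on_SigmaI[where g = "\<lambda>k. tmzv ls k / real k ^ l"])
       (use inner * in \<open>auto simp: summable_on_def t_def simp del: prod.lessThan_Suc intro!: prod_nonneg\<close>)
  then have "((\<lambda>(k, ms). t (k # ms)) has_sum (\<Sum>n. tmzv ls n / real n ^ l)) (Sigma {0<..} (chains (length ls)))"
    by (intro has_sum_SigmaI[OF _ *]) (use inner in auto)
  moreover have "bij_betw (\<lambda>(k, ms). k # ms) (Sigma {0<..} (chains (length ls))) A"
    by (rule bij_betwI[of _ _ _ "\<lambda>ms. (hd ms, tl ms)"])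
       (fastforce simp: chains_def A_def length_Suc_conv)+
  ultimately have "(t has_sum (\<Sum>n. tmzv ls n / real n ^ l)) A"
    by (subst has_sum_reindex_bij_betw[symmetric]) (auto simp: case_prod_unfold)
  then have "mzv (l # ls) = (\<Sum>n. tmzv ls n / real n ^ l)"
    unfolding mzv_def A_def t_def by (rule infsumI)
  with sm show ?thesis by (simp add: summable_sums)
qed

lemma tmzv_tendsto_mzv:
  assumes "admissible ls"
  shows "tmzv ls \<longlonglongrightarrow> mzv ls"
proof (cases ls)
  case (Cons l ls')
  then show ?thesis using mzv_sums[of l ls'] assms unfolding sums_def Cons by (simp flip: tmzv.simps)
qed (use assms in \<open>simp add: admissible_def\<close>)

section \<open>Relations between multiple zeta values\<close>

lemma tendsto_sum_list_tmzv:
  assumes "\<forall>x\<in>set xss. admissible x"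
  shows "(\<lambda>N. \<Sum>x\<leftarrow>xss. tmzv x N) \<longlonglongrightarrow> (\<Sum>x\<leftarrow>xss. mzv x)"
  using assms by (induction xss) (auto intro!: tendsto_add tmzv_tendsto_mzv)

text \<open>Each term tends to zero, and \<open>H\<^bsub>N-1\<^esub> - H\<^bsub>N-1-q\<^esub> \<le> H\<^sub>q\<close> supplies a summable majorant, so Tannery's
  theorem applies.\<close>
lemma hoffman_remainder_tendsto_0:
  assumes "admissible (l # ls)"
  shows "hoffman_remainder (l # ls) \<longlonglongrightarrow> 0"
proof -
  define a where "a = (\<lambda>q N. if q < N then tmzv ls q / real q ^ l * (harm (N - 1 - q) - harm (N - 1)) else 0)"
  define M where "M = (\<lambda>q. tmzv ls q * harm q ^ 1 / real q ^ l)"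
  have diff: "harm (m + q) - harm m \<le> (harm q :: real)" for m q
  proof (induction q)
    case (Suc q)
    have "inverse (real (Suc (m + q))) \<le> inverse (real (Suc q))"
      by (intro le_imp_inverse_le) auto
    then show ?case using Suc unfolding add_Suc_right harm_Suc by linarith
  qed (simp add: harm_def)
  have bound: "norm (a q N) \<le> M q" for q N
  proof (cases "q < N")
    case True
    have "harm (N - 1) - harm (N - 1 - q) \<le> (harm q :: real)"
      using diff[of "N - 1 - q" q] True by simp
    moreover have "harm (N - 1 - q) \<le> (harm (N - 1) :: real)" by (rule harm_mono) simp
    ultimately have "\<bar>harm (N - 1 - q) - harm (N - 1)\<bar> \<le> (harm q :: real)" by linarith
    then have "tmzv ls q / real q ^ l * \<bar>harm (N - 1 - q) - harm (N - 1)\<bar> \<le> tmzv ls q / real q ^ l * harm q"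
      by (intro mult_left_mono) (auto simp: tmzv_nonneg)
    then show ?thesis using True by (simp add: a_def M_def abs_mult tmzv_nonneg)
  qed (auto simp: a_def M_def tmzv_nonneg harm_nonneg)
  have lim: "a q \<longlonglongrightarrow> 0" for q
  proof -
    have "(\<lambda>m. harm (m + q) - harm m :: real) \<longlonglongrightarrow> 0"
    proof (induction q)
      case (Suc q)
      have "(\<lambda>m. inverse (real (Suc (m + q)))) \<longlonglongrightarrow> 0"
        using LIMSEQ_ignore_initial_segment[OF LIMSEQ_inverse_real_of_nat, of q] by simp
      from tendsto_add[OF Suc this] show ?case by (simp add: harm_Suc algebra_simps)
    qed simp
    then have "(\<lambda>m. tmzv ls q / real q ^ l * - (harm (m + q) - harm m)) \<longlonglongrightarrow> tmzv ls q / real q ^ l * - 0"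
      by (intro tendsto_intros)
    moreover have "a q (m + Suc q) = tmzv ls q / real q ^ l * - (harm (m + q) - harm m)" for m
      by (simp add: a_def)
    ultimately have "(\<lambda>m. a q (m + Suc q)) \<longlonglongrightarrow> 0" by simp
    then show ?thesis by (rule LIMSEQ_offset)
  qed
  have "((\<lambda>N. \<Sum>q. a q N) \<longlongrightarrow> (\<Sum>q::nat. 0)) sequentially"
    using bound summable_tmzv_harm[OF assms, of 1]
    by (intro tannerys_theorem[THEN conjunct2, THEN conjunct2, of _ _ _ M] lim)
       (auto simp: M_def case_prod_unfold)
  moreover have "(\<Sum>q. a q N) = hoffman_remainder (l # ls) N" for N
    by (subst suminf_finite[of "{..<N}"]) (auto simp: a_def)
  ultimately show ?thesis by (simp del: hoffman_remainder.simps)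
qed

lemma inserts_props:
  assumes "x \<in> set (inserts k ls)"
  shows "length x = Suc (length ls) \<and> sum_list x = k + sum_list ls \<and> (k \<ge> 2 \<longrightarrow> admissible ls \<longrightarrow> admissible x) \<and>
   (k \<ge> 1 \<longrightarrow> (\<forall>j\<in>set ls. j \<ge> 1) \<longrightarrow> (\<forall>j\<in>set x. j \<ge> 1))"
  using assms
  by (induction ls arbitrary: x) (auto simp: admissible_Cons_iff)

lemma merges_props:
  assumes "x \<in> set (merges k ls)"
  shows "length x = length ls \<and> sum_list x = k + sum_list ls \<and> (admissible ls \<longrightarrow> admissible x) \<and>
     ((\<forall>j\<in>set ls. j \<ge> 1) \<longrightarrow> (\<forall>j\<in>set x. j \<ge> 1))"
  using assms
  by (induction ls arbitrary: x) (auto simp: admissible_Cons_iff)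

lemma splits_props:
  assumes "x \<in> set (splits ls)"
  shows "length x = Suc (length ls) \<and> sum_list x = 1 + sum_list ls \<and> (admissible ls \<longrightarrow> admissible x) \<and>
     ((\<forall>j\<in>set ls. j \<ge> 1) \<longrightarrow> (\<forall>j\<in>set x. j \<ge> 1))"
  using assms
  by (induction ls arbitrary: x) (auto simp: admissible_Cons_iff)

lemma mzv_stuffle:
  assumes "k \<ge> 2" "admissible ls"
  shows "mzv [k] * mzv ls = (\<Sum>x\<leftarrow>inserts k ls. mzv x) + (\<Sum>x\<leftarrow>merges k ls. mzv x)"
proof (rule LIMSEQ_unique)
  show "(\<lambda>N. tmzv [k] N * tmzv ls N) \<longlonglongrightarrow> mzv [k] * mzv ls"
    using assms by (intro tendsto_mult tmzv_tendsto_mzv) (auto simp: admissible_def)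
  show "(\<lambda>N. tmzv [k] N * tmzv ls N) \<longlonglongrightarrow> (\<Sum>x\<leftarrow>inserts k ls. mzv x) + (\<Sum>x\<leftarrow>merges k ls. mzv x)"
    unfolding tmzv_stuffle using assms inserts_props merges_props
    by (intro tendsto_add tendsto_sum_list_tmzv) blast+
qed

lemma hoffman_relation:
  assumes "admissible ls"
  shows "(\<Sum>x\<leftarrow>merges 1 ls. mzv x) = (\<Sum>x\<leftarrow>splits ls. mzv x)"
proof -
  have pos: "\<forall>k\<in>set ls. k \<ge> 1" using assms by (simp add: admissible_def)
  have "(\<lambda>N. \<Sum>x\<leftarrow>splits ls. tmzv x N) \<longlonglongrightarrow> (\<Sum>x\<leftarrow>splits ls. mzv x)"
    using assms splits_props by (intro tendsto_sum_list_tmzv) blast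
  moreover have "hoffman_remainder ls \<longlonglongrightarrow> 0"
    using assms hoffman_remainder_tendsto_0 by (cases ls) (auto simp: admissible_def)
  then have "(\<lambda>N. (\<Sum>x\<leftarrow>merges 1 ls. tmzv x N) + hoffman_remainder ls N) \<longlonglongrightarrow> (\<Sum>x\<leftarrow>merges 1 ls. mzv x) + 0"
    using assms merges_props by (intro tendsto_add tendsto_sum_list_tmzv) blast+
  then have "(\<lambda>N. \<Sum>x\<leftarrow>splits ls. tmzv x N) \<longlonglongrightarrow> (\<Sum>x\<leftarrow>merges 1 ls. mzv x)"
    by (simp add: tmzv_splits[OF pos])
  ultimately show ?thesis by (rule LIMSEQ_unique[symmetric])
qed

section \<open>Power sums acting on indices\<close>

lemma sum_list_merges:
  "(\<Sum>x\<leftarrow>merges k ls. f x) = (\<Sum>i<length ls. f (ls[i := ls ! i + k]))"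
proof (induction ls arbitrary: f)
  case (Cons l ls)
  show ?case
    using Cons[of "\<lambda>x. f (l # x)"] by (simp add: o_def sum.lessThan_Suc_shift add.commute del: sum.lessThan_Suc)
qed simp

text \<open>Smallest value that \<open>sum_indices\<close> permits for the entry at position \<open>i\<close>.\<close>
definition min_entry :: "nat \<Rightarrow> nat \<Rightarrow> nat" where
  "min_entry m i = (if i = 0 then m + 1 else 1)"

lemma sum_indices_iff:
  assumes "n \<ge> 1"
  shows "ls \<in> sum_indices l m n \<longleftrightarrow> length ls = n \<and> (\<forall>i<n. min_entry m i \<le> ls ! i) \<and> sum_list ls = l"
proof (cases ls)
  case (Cons a as)
  have "(\<forall>i<Suc (length as). min_entry m i \<le> (a # as) ! i) \<longleftrightarrow> m + 1 \<le> a \<and> (\<forall>k\<in>set as. k \<ge> 1)"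
    by (auto simp: min_entry_def All_less_Suc2 all_set_conv_all_nth)
  then show ?thesis using assms by (auto simp: Cons sum_indices_def)
qed (use assms in \<open>auto simp: sum_indices_def\<close>)

lemma sum_min_entry: "n \<ge> 1 \<Longrightarrow> (\<Sum>i<n. min_entry m i) = m + n"
  by (induction n rule: nat_induct_at_least) (auto simp: min_entry_def)

text \<open>Newton's identity \<open>j h\<^sub>j = \<Sum>\<^bsub>1\<le>k\<le>j\<^esub> p\<^sub>k h\<^bsub>j-k\<^esub>\<close>: an index of the restricted sum arises by
  raising entry \<open>i\<close> by \<open>k \<ge> 1\<close> in as many ways as its entries exceed their minimal values, and the
  total excess is \<open>l - (m + n)\<close> for every index.\<close>
lemma sum_indices_excess:
  fixes f :: "nat list \<Rightarrow> real"
  assumes n: "n \<ge> 1"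
  shows "real (l - (m + n)) * (\<Sum>ls\<in>sum_indices l m n. f ls) =
    (\<Sum>k\<in>{1..l - (m + n)}. \<Sum>ls\<in>sum_indices (l - k) m n. \<Sum>x\<leftarrow>merges k ls. f x)"
proof -
  define S1 where "S1 = (SIGMA k:{1..l - (m + n)}. sum_indices (l - k) m n \<times> {..<n})"
  \<comment> \<open>\<open>S1\<close> records the index before entry \<open>i\<close> is raised by \<open>k\<close>, and \<open>S2\<close> the index after.\<close>
  define S2 where "S2 = (SIGMA ls:sum_indices l m n. SIGMA i:{..<n}. {1..ls ! i - min_entry m i})"
  \<comment> \<open>The number of ways \<open>(i, k)\<close> to obtain a given index.\<close>
  have excess: "(\<Sum>i<n. ls ! i - min_entry m i) = l - (m + n)" if "ls \<in> sum_indices l m n" for ls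
  proof -
    have "(\<Sum>i<n. ls ! i - min_entry m i) = (\<Sum>i<n. ls ! i) - (\<Sum>i<n. min_entry m i)"
      using that n by (intro sum_subtractf_nat) (auto simp: sum_indices_iff)
    also have "(\<Sum>i<n. ls ! i) = l"
      using that by (auto simp: sum_indices_def sum_list_sum_nth atLeast0LessThan)
    finally show ?thesis using sum_min_entry[OF n, of m] by simp
  qed
  have le: "ls ! i - min_entry m i \<le> l - (m + n)" if "ls \<in> sum_indices l m n" "i < n" for ls i
    unfolding excess[OF that(1), symmetric] using that(2) by (intro member_le_sum) auto
  have "(\<Sum>k\<in>{1..l - (m + n)}. \<Sum>ls\<in>sum_indices (l - k) m n. \<Sum>x\<leftarrow>merges k ls. f x) =
     (\<Sum>k\<in>{1..l - (m + n)}. \<Sum>ls\<in>sum_indices (l - k) m n. \<Sum>i<n. f (ls[i := ls ! i + k]))"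
    by (intro sum.cong refl) (simp add: sum_list_merges sum_indices_def)
  also have "\<dots> = (\<Sum>(k, ls, i)\<in>S1. f (ls[i := ls ! i + k]))"
    unfolding S1_def by (simp add: sum.Sigma sum.cartesian_product finite_sum_indices case_prod_unfold)
  also have "\<dots> = (\<Sum>(ls, i, k)\<in>S2. f ls)"
  proof (rule sum.reindex_bij_witness[of _ "\<lambda>(ls, i, k). (k, ls[i := ls ! i - k], i)"
        "\<lambda>(k, ls, i). (ls[i := ls ! i + k], i, k)"], goal_cases)
    case (1 x)
    then show ?case by (auto simp: S1_def sum_indices_iff[OF n])
  next
    case (2 x)
    then obtain k ls i where x: "x = (k, ls, i)" "ls \<in> sum_indices (l - k) m n" "i < n"
      "1 \<le> k" "k \<le> l - (m + n)" by (auto simp: S1_def)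
    have "min_entry m i \<le> ls ! i" using x(2,3) by (simp add: sum_indices_iff[OF n])
    then show ?case using x
      by (auto simp: S2_def sum_indices_iff[OF n] nth_list_update sum_list_update)
  next
    case (3 y)
    then show ?case by (auto simp: S2_def sum_indices_iff[OF n])
  next
    case (4 y)
    then obtain ls i k where y: "y = (ls, i, k)" "ls \<in> sum_indices l m n" "i < n" "1 \<le> k"
      "k \<le> ls ! i - min_entry m i" by (auto simp: S2_def)
    have "ls ! i \<le> sum_list ls" using y by (intro elem_le_sum_list) (auto simp: sum_indices_def)
    then show ?case using y le[OF y(2,3)]
      by (auto simp: S1_def sum_indices_iff[OF n] nth_list_update sum_list_update)
  next
    case (5 x)
    show ?case by (simp add: case_prod_unfold)
  qed
  also have "\<dots> = (\<Sum>ls\<in>sum_indices l m n. \<Sum>i<n. \<Sum>k\<in>{1..ls ! i - min_entry m i}. f ls)"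
  proof -
    have "(\<Sum>i<n. \<Sum>k\<in>{1..ls ! i - min_entry m i}. f ls) =
        (\<Sum>(i, k)\<in>(SIGMA i:{..<n}. {1..ls ! i - min_entry m i}). f ls)" for ls
      by (rule sum.Sigma) auto
    moreover have "(\<Sum>(ls, i, k)\<in>S2. f ls) =
        (\<Sum>ls\<in>sum_indices l m n. \<Sum>(i, k)\<in>(SIGMA i:{..<n}. {1..ls ! i - min_entry m i}). f ls)"
      unfolding S2_def by (rule sum.Sigma[symmetric]) (auto simp: finite_sum_indices)
    ultimately show ?thesis by simp
  qed
  also have "\<dots> = (\<Sum>ls\<in>sum_indices l m n. real (\<Sum>i<n. ls ! i - min_entry m i) * f ls)"
    by (simp add: sum_distrib_right)
  also have "\<dots> = (\<Sum>ls\<in>sum_indices l m n. real (l - (m + n)) * f ls)"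
    by (intro sum.cong refl) (simp add: excess)
  finally show ?thesis by (simp add: sum_distrib_left)
qed

section \<open>Depth raising modulo products\<close>

lemma rat_subspace_cancel_nat:
  assumes "rat_real.subspace V" "real k * x \<in> V" "k > 0"
  shows "x \<in> V"
  using rat_real.subspace_scale[OF assms(1,2), of "1 / of_nat k"] assms(3)
  by (simp add: of_rat_divide)

lemma subspace_sum_list:
  assumes "rat_real.subspace V" "\<And>x. x \<in> set xs \<Longrightarrow> f x \<in> V"
  shows "(\<Sum>x\<leftarrow>xs. f x) \<in> V"
  using assms(2) by (induction xs) (auto intro: rat_real.subspace_add[OF assms(1)] rat_real.subspace_0[OF assms(1)])

lemma subspace_mzv_sum:
  "rat_real.subspace (mzv_depth_space l d + mzv_product_space l)"
proof -
  have "rat_real.subspace {x + y | x y. x \<in> mzv_depth_space l d \<and> y \<in> mzv_product_space l}"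
    unfolding mzv_depth_space_def mzv_product_space_def
    by (intro rat_real.subspace_sums rat_real.subspace_span)
  moreover have "{x + y | x y. x \<in> mzv_depth_space l d \<and> y \<in> mzv_product_space l} =
      mzv_depth_space l d + mzv_product_space l"
    by (auto simp: set_plus_def)
  ultimately show ?thesis by simp
qed

lemma mzv_in_space:
  assumes "admissible ls" "sum_list ls = l" "length ls = d"
  shows "mzv ls \<in> mzv_depth_space l d + mzv_product_space l"
proof -
  have "mzv ls \<in> mzv_depth_space l d"
    unfolding mzv_depth_space_def using assms by (intro rat_real.span_base) auto
  then have "mzv ls + 0 \<in> mzv_depth_space l d + mzv_product_space l"
    by (intro set_plus_intro) (auto simp: mzv_product_space_def rat_real.span_zero)
  then show ?thesis by simp
qed

lemma product_space_subset:
  "mzv_product_space l \<subseteq> mzv_depth_space l d + mzv_product_space l"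
proof
  fix x assume "x \<in> mzv_product_space l"
  then have "0 + x \<in> mzv_depth_space l d + mzv_product_space l"
    by (intro set_plus_intro) (auto simp: mzv_depth_space_def rat_real.span_zero)
  then show "x \<in> mzv_depth_space l d + mzv_product_space l" by simp
qed

lemma mzv_mult_in_product_space:
  assumes "admissible ks" "admissible ls" "sum_list ks + sum_list ls = l"
  shows "mzv ks * mzv ls \<in> mzv_product_space l"
  unfolding mzv_product_space_def
  by (intro rat_real.span_base UnI1 CollectI exI[of _ "[ks, ls]"]) (use assms in auto)

text \<open>For \<open>k = 1\<close> Hoffman's relation rewrites the sum in depth \<open>n + 1\<close>. For \<open>k \<ge> 2\<close> it is what the stuffle
  product with \<open>\<zeta>(k)\<close> leaves in depth \<open>n\<close>; for \<open>k = 1\<close> that factor would diverge.\<close>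
lemma sum_merges_in_space:
  assumes "k \<ge> 1" "admissible ls" "k + sum_list ls = l" "length ls = n"
  shows "(\<Sum>x\<leftarrow>merges k ls. mzv x) \<in> mzv_depth_space l (n + 1) + mzv_product_space l" (is "_ \<in> ?W")
proof (cases "k = 1")
  case True
  have "(\<Sum>x\<leftarrow>splits ls. mzv x) \<in> ?W"
    using assms True splits_props[of _ ls]
    by (intro subspace_sum_list subspace_mzv_sum mzv_in_space) auto
  then show ?thesis using hoffman_relation[OF assms(2)] True by simp
next
  case False
  with assms have k: "k \<ge> 2" by simp
  have "(\<Sum>x\<leftarrow>inserts k ls. mzv x) \<in> ?W"
    using assms k inserts_props[of _ k ls]
    by (intro subspace_sum_list subspace_mzv_sum mzv_in_space) auto
  moreover have "mzv [k] * mzv ls \<in> ?W"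
    using assms k by (intro subsetD[OF product_space_subset] mzv_mult_in_product_space) (auto simp: admissible_def)
  ultimately have "mzv [k] * mzv ls - (\<Sum>x\<leftarrow>inserts k ls. mzv x) \<in> ?W"
    by (intro rat_real.subspace_diff[OF subspace_mzv_sum])
  then show ?thesis using mzv_stuffle[OF k assms(2)] by simp
qed

lemma sum_mzv_in_space_excess:
  assumes "m \<ge> 1" "n \<ge> 1" "l > m + n"
  shows "(\<Sum>ls\<in>sum_indices l m n. mzv ls) \<in> mzv_depth_space l (n + 1) + mzv_product_space l"
proof (rule rat_subspace_cancel_nat[OF subspace_mzv_sum])
  show "real (l - (m + n)) * (\<Sum>ls\<in>sum_indices l m n. mzv ls) \<in> mzv_depth_space l (n + 1) + mzv_product_space l"
    unfolding sum_indices_excess[OF assms(2)]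
  proof (intro rat_real.subspace_sum[OF subspace_mzv_sum])
    fix k ls assume k: "k \<in> {1..l - (m + n)}" and ls: "ls \<in> sum_indices (l - k) m n"
    then have "admissible ls" "sum_list ls = l - k" "length ls = n"
      using assms by (auto simp: sum_indices_def admissible_def)
    then show "(\<Sum>x\<leftarrow>merges k ls. mzv x) \<in> mzv_depth_space l (n + 1) + mzv_product_space l"
      using k by (intro sum_merges_in_space) auto
  qed
qed (use assms in auto)

section \<open>Power series and the beta series\<close>

text \<open>Tonelli's theorem for unordered sums.\<close>
lemma has_sum_Sigma_nonneg:
  fixes f :: "'a \<times> 'b \<Rightarrow> real"
  assumes "\<And>x. x \<in> A \<Longrightarrow> ((\<lambda>y. f (x, y)) has_sum g x) (B x)" "(g has_sum S) A"
    and "\<And>x y. x \<in> A \<Longrightarrow> y \<in> B x \<Longrightarrow> f (x, y) \<ge> 0"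
  shows "(f has_sum S) (Sigma A B)"
  using assms summable_on_SigmaI[where f = f and g = g and A = A and B = B]
  by (intro has_sum_SigmaI[where g = g]) (auto simp: summable_on_def)

lemma fps_conv_radius_ge_right:
  fixes f :: "real fps"
  assumes "\<And>x. 0 < x \<Longrightarrow> x < e \<Longrightarrow> summable (\<lambda>n. fps_nth f n * x ^ n)"
  shows "fps_conv_radius f \<ge> ereal e"
  unfolding fps_conv_radius_def
  by (rule conv_radius_geI_ex) (use assms in force)

text \<open>Equality is required only to the right of zero, where the positivity arguments of the
  generating functions are available. A nonzero difference, divided by its leading power, would have a
  nonzero limit at zero.\<close>
lemma fps_eqI_right:
  fixes f g :: "real fps"
  assumes "e > 0" "fps_conv_radius f \<ge> ereal e" "fps_conv_radius g \<ge> ereal e"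
    and eq: "\<And>x. 0 < x \<Longrightarrow> x < e \<Longrightarrow> eval_fps f x = eval_fps g x"
  shows "f = g"
proof (rule ccontr)
  assume "f \<noteq> g"
  define h where "h = f - g"
  have h: "h \<noteq> 0" using \<open>f \<noteq> g\<close> by (simp add: h_def)
  \<comment> \<open>The quotient of \<open>h\<close> by its leading power, so that the constant term of \<open>d\<close> is not zero.\<close>
  define d where "d = fps_shift (subdegree h) h"
  have rad_h: "fps_conv_radius h \<ge> ereal e"
    using fps_conv_radius_diff[of f g] assms(2,3) by (simp add: h_def min_def split: if_splits)
  have rad: "fps_conv_radius d \<ge> ereal e" using rad_h by (simp add: d_def)
  have "ereal (norm (0::real)) < fps_conv_radius d"
    using rad assms(1) by (intro less_le_trans[OF _ rad]) simp
  then have "isCont (eval_fps d) 0" by (rule continuous_eval_fps)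
  then have "(eval_fps d \<longlongrightarrow> eval_fps d 0) (at_right 0)"
    unfolding continuous_within by (rule tendsto_mono[OF at_le, rotated]) simp
  moreover have "eventually (\<lambda>x. eval_fps d x = 0) (at_right 0)"
    unfolding eventually_at_right_field
  proof (intro exI[of _ e] conjI allI impI)
    fix x :: real assume x: "0 < x" "x < e"
    have "ereal (norm x) < ereal e" using x by simp
    then have le: "ereal (norm x) < fps_conv_radius f" "ereal (norm x) < fps_conv_radius g"
      "ereal (norm x) < fps_conv_radius h"
      using assms(2,3) rad_h by (blast intro: less_le_trans)+
    have "eval_fps h x = 0" unfolding h_def using eq[OF x] le by (simp add: eval_fps_diff)
    then show "eval_fps d x = 0"
      unfolding d_def using le x by (subst eval_fps_shift) auto
  qed (use assms in auto)
  then have "(eval_fps d \<longlongrightarrow> 0) (at_right 0)" by (rule tendsto_eventually)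
  ultimately have "eval_fps d 0 = 0"
    by (rule tendsto_unique[OF trivial_limit_at_right_real])
  then show False using h by (simp add: eval_fps_at_0 d_def)
qed

lemma powser_unique_right:
  fixes c d :: "nat \<Rightarrow> real"
  assumes c: "\<And>x. 0 < x \<Longrightarrow> x < 1 \<Longrightarrow> (\<lambda>n. c n * x ^ n) sums s x"
    and d: "\<And>x. 0 < x \<Longrightarrow> x < 1 \<Longrightarrow> (\<lambda>n. d n * x ^ n) sums s x"
  shows "c = d"
proof -
  have "Abs_fps c = Abs_fps d"
  proof (rule fps_eqI_right[of 1])
    show "fps_conv_radius (Abs_fps c) \<ge> ereal 1"
      by (rule fps_conv_radius_ge_right) (use c in \<open>auto simp: sums_iff\<close>)
    show "fps_conv_radius (Abs_fps d) \<ge> ereal 1"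
      by (rule fps_conv_radius_ge_right) (use d in \<open>auto simp: sums_iff\<close>)
    show "eval_fps (Abs_fps c) x = eval_fps (Abs_fps d) x" if "0 < x" "x < 1" for x
      using c[OF that] d[OF that] by (simp add: eval_fps_def sums_iff)
  qed simp
  then show ?thesis by (metis fps_nth_Abs_fps ext)
qed

lemma double_powser_rows:
  fixes u :: "nat \<Rightarrow> nat \<Rightarrow> real"
  assumes sm: "((\<lambda>(m, n). u m n * a ^ m * b ^ n) has_sum S) UNIV" and a: "0 < a" 
  shows "summable (\<lambda>n. u m n * b ^ n)" "(\<lambda>m. (\<Sum>n. u m n * b ^ n) * a ^ m) sums S"
proof -
  have sm': "((\<lambda>(m, n). u m n * a ^ m * b ^ n) has_sum S) (UNIV \<times> UNIV)" using sm by simp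
  have row: "(\<lambda>n. u m n * b ^ n) summable_on UNIV" for m
  proof -
    have "(\<lambda>n. u m n * a ^ m * b ^ n) summable_on UNIV"
      using summable_on_SigmaD1[of "\<lambda>m n. u m n * a ^ m * b ^ n" UNIV "\<lambda>_. UNIV" m] sm'
      by (auto simp: summable_on_def)
    then have "(\<lambda>n. 1 / a ^ m * (u m n * a ^ m * b ^ n)) summable_on UNIV"
      by (rule summable_on_cmult_right)
    then show ?thesis using a by simp
  qed
  then show "summable (\<lambda>n. u m n * b ^ n)" by (rule summable_on_imp_summable)
  have "((\<lambda>n. u m n * b ^ n) has_sum (\<Sum>n. u m n * b ^ n)) UNIV" for m
    using row[of m] has_sum_infsum[OF row[of m]] sums_unique[OF has_sum_imp_sums[OF has_sum_infsum[OF row[of m]]]]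
    by simp
  from has_sum_cmult_right[OF this, of "a ^ _"]
  have "((\<lambda>n. u m n * a ^ m * b ^ n) has_sum (\<Sum>n. u m n * b ^ n) * a ^ m) UNIV" for m
    by (simp add: mult_ac)
  then have "((\<lambda>m. (\<Sum>n. u m n * b ^ n) * a ^ m) has_sum S) UNIV"
    by (intro has_sum_SigmaD[OF sm']) simp
  then show "(\<lambda>m. (\<Sum>n. u m n * b ^ n) * a ^ m) sums S" by (rule has_sum_imp_sums)
qed

lemma double_powser_unique:
  fixes u v :: "nat \<Rightarrow> nat \<Rightarrow> real"
  assumes u: "\<And>a b. 0 < a \<Longrightarrow> a < 1 \<Longrightarrow> 0 < b \<Longrightarrow> b < 1 \<Longrightarrow> ((\<lambda>(m, n). u m n * a ^ m * b ^ n) has_sum S a b) UNIV"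
    and v: "\<And>a b. 0 < a \<Longrightarrow> a < 1 \<Longrightarrow> 0 < b \<Longrightarrow> b < 1 \<Longrightarrow> ((\<lambda>(m, n). v m n * a ^ m * b ^ n) has_sum S a b) UNIV"
  shows "u = v"
proof
  fix m
  have "(\<lambda>m. \<Sum>n. u m n * b ^ n) = (\<lambda>m. \<Sum>n. v m n * b ^ n)" if "0 < b" "b < 1" for b
    by (rule powser_unique_right[where s = "\<lambda>a. S a b"])
       (use u v that double_powser_rows(2) in blast)+
  then have "(\<Sum>n. u m n * b ^ n) = (\<Sum>n. v m n * b ^ n)" if "0 < b" "b < 1" for b
    using that by meson
  moreover have "summable (\<lambda>n. u m n * b ^ n)" "summable (\<lambda>n. v m n * b ^ n)" if "0 < b" "b < 1" for b
    using double_powser_rows(1)[OF u[of "1/2" b]] double_powser_rows(1)[OF v[of "1/2" b]] that by simp_all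
  ultimately show "u m = v m"
    by (intro powser_unique_right[where s = "\<lambda>b. \<Sum>n. u m n * b ^ n"]) (auto simp: sums_iff)
qed

text \<open>The coefficient of \<open>t\<^sup>j\<close> in \<open>(1 - t)\<^bsup>-b\<^esup>\<close>.\<close>
definition rising :: "real \<Rightarrow> nat \<Rightarrow> real" where
  "rising b j = pochhammer b j / fact j"

lemma rising_0 [simp]: "rising b 0 = 1"
  by (simp add: rising_def)

lemma rising_Suc: "rising b (Suc j) = rising b j * (b + j) / (j + 1)"
  by (simp add: rising_def pochhammer_Suc divide_simps)

lemma rising_nonneg: "b \<ge> 0 \<Longrightarrow> rising b j \<ge> 0"
  by (auto simp: rising_def pochhammer_prod intro!: divide_nonneg_nonneg prod_nonneg)

lemma rising_antimono:
  assumes "0 \<le> b" "b \<le> 1"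
  shows "rising b (Suc j) \<le> rising b j"
proof -
  have "rising b j * ((b + j) / (j + 1)) \<le> rising b j * 1"
    using assms by (intro mult_left_mono rising_nonneg) auto
  then show ?thesis by (simp add: rising_Suc)
qed

lemma rising_one: "rising 1 n = 1"
  by (simp add: rising_def flip: pochhammer_fact)

text \<open>The Chu-Vandermonde identity, that is, the product of two binomial series.\<close>
lemma rising_convolution: "(\<Sum>i\<le>n. rising u i * rising v (n - i)) = rising (u + v) n"
proof -
  have "(\<Sum>i\<le>n. rising u i * rising v (n - i)) =
      (\<Sum>i\<le>n. of_nat (n choose i) * pochhammer u i * pochhammer v (n - i) / fact n)"
    by (intro sum.cong refl) (simp add: rising_def binomial_fact)
  then show ?thesis
    by (simp add: rising_def pochhammer_binomial_sum sum_divide_distrib)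
qed

lemma rising_power_series:
  assumes "0 \<le> t" "t < 1"
  shows "(\<lambda>j. rising b j * t ^ j) sums (1 - t) powr (- b)"
proof -
  have "(\<lambda>n. (-b gchoose n) * (-t) ^ n) sums (1 + (-t)) powr (-b)"
    using assms by (intro gen_binomial_real) auto
  moreover have "(-b gchoose n) * (-t) ^ n = rising b n * t ^ n" for n
  proof -
    have "(-1) ^ n * (-t) ^ n = t ^ n" by (simp flip: power_mult_distrib)
    then show ?thesis by (simp add: gbinomial_pochhammer rising_def)
  qed
  ultimately show ?thesis by simp
qed

text \<open>Expand \<open>(1 - t)\<^bsup>-b\<^esup>\<close> in the beta integral; all terms are nonnegative, so monotone convergence
  allows integration term by term. The open interval avoids \<open>t = 1\<close>, where the binomial series
  diverges.\<close>
lemma beta_series: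
  fixes x b :: real
  assumes "x > 0" "0 < b" "b < 1"
  shows "(\<lambda>j. rising b j / (real j + x)) sums Beta x (1 - b)"
proof -
  define f where "f = (\<lambda>K t. \<Sum>j<K. rising b j * (t powr (x + j - 1)))"
  define g where "g = (\<lambda>t. t powr (x - 1) * (1 - t) powr (- b))"
  have g: "(g has_integral Beta x (1 - b)) {0<..<1}"
    using has_integral_Beta_real[of x "1 - b"] assms
    by (simp add: g_def has_integral_Icc_iff_Ioo)
  have f: "(f K has_integral (\<Sum>j<K. rising b j / (real j + x))) {0<..<1}" for K
  proof -
    have "((\<lambda>t. t powr (x + j - 1)) has_integral (1 / (real j + x))) {0..1}" for j
      using has_integral_powr_from_0[of "x + j - 1" 1] assms by (simp add: add.commute)
    then have "((\<lambda>t. rising b j * t powr (x + j - 1)) has_integral (rising b j * (1 / (real j + x)))) {0..1}" for j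
      by (rule has_integral_mult_right)
    then have "(f K has_integral (\<Sum>j<K. rising b j * (1 / (real j + x)))) {0..1}"
      unfolding f_def by (intro has_integral_sum) auto
    then show ?thesis by (simp add: has_integral_Icc_iff_Ioo)
  qed
  have f_eq: "f K t = t powr (x - 1) * (\<Sum>j<K. rising b j * t ^ j)" if "t \<in> {0<..<1}" for t K
    unfolding f_def sum_distrib_left
  proof (intro sum.cong refl)
    fix j
    have "t powr (x + j - 1) = t powr (x - 1) * t powr real j"
      by (simp flip: powr_add add: algebra_simps)
    then show "rising b j * t powr (x + real j - 1) = t powr (x - 1) * (rising b j * t ^ j)"
      using that by (simp add: powr_realpow)
  qed
  have lim: "(\<lambda>K. f K t) \<longlonglongrightarrow> g t" if t: "t \<in> {0<..<1}" for t
    unfolding f_eq[OF t] g_def using rising_power_series[of t b] t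
    by (intro tendsto_intros) (auto simp: sums_def)
  have mono: "f K t \<le> f (Suc K) t" if "t \<in> {0<..<1}" for K t
    using assms by (simp add: f_def rising_nonneg)
  have le: "f K t \<le> g t" if "t \<in> {0<..<1}" for K t
    using lim[OF that] mono[OF that] by (intro incseq_le) (auto simp: incseq_Suc_iff)
  have bdd: "integral {0<..<1} (f K) \<le> Beta x (1 - b)" for K
    using has_integral_le[OF f g] le f[of K] by (simp add: integral_unique)
  have "bounded (range (\<lambda>K. integral {0<..<1} (f K)))"
  proof (rule boundedI)
    fix r assume "r \<in> range (\<lambda>K. integral {0<..<1} (f K))"
    then obtain K where r: "r = integral {0<..<1} (f K)" by auto
    have "r \<ge> 0" unfolding r f_def using assms
      by (intro integral_nonneg) (use f in \<open>auto simp: f_def integrable_on_def rising_nonneg intro!: sum_nonneg\<close>)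
    then show "norm r \<le> Beta x (1 - b)" using bdd[of K] r by simp
  qed
  then have "(\<lambda>K. integral {0<..<1} (f K)) \<longlonglongrightarrow> integral {0<..<1} g"
    using monotone_convergence_increasing[of f "{0<..<1}" g] f mono lim by (auto simp: integrable_on_def)
  then show ?thesis
    using integral_unique[OF f] integral_unique[OF g] by (simp add: sums_def)
qed

section \<open>Truncated sums over all indices of given depth and weight\<close>

text \<open>Indices of depth \<open>r\<close> whose entries exceed \<open>1\<close> by \<open>j\<close> in total.\<close>
definition excess_indices :: "nat \<Rightarrow> nat \<Rightarrow> nat list set" where
  "excess_indices r j = {ls. length ls = r \<and> (\<forall>k\<in>set ls. k \<ge> 1) \<and> sum_list ls = r + j}"

lemma length_le_sum_list: "\<forall>k\<in>set ls. k \<ge> 1 \<Longrightarrow> length ls \<le> sum_list (ls :: nat list)"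
  by (induction ls) auto

lemma finite_excess_indices: "finite (excess_indices r j)"
proof (rule finite_subset)
  show "excess_indices r j \<subseteq> {ls. set ls \<subseteq> {..r + j} \<and> length ls = r}"
    by (auto simp: excess_indices_def dest: member_le_sum_list)
qed (simp add: finite_lists_length_eq)

lemma excess_indices_0: "excess_indices 0 j = (if j = 0 then {[]} else {})"
  by (auto simp: excess_indices_def)

text \<open>The form of the hypothesis covers both the set \<open>excess_indices (Suc r) j\<close> itself (with \<open>c = 0\<close>)
  and the restricted index sets, where \<open>Suc c\<close> is the bound on the first entry.\<close>
lemma sum_Cons_excess_indices:
  fixes f :: "nat list \<Rightarrow> real"
  assumes "A = {l # ls | l ls. l \<ge> Suc c \<and> length ls = r \<and> (\<forall>k\<in>set ls. k \<ge> 1) \<and> l + sum_list ls = Suc c + r + j}"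
  shows "sum f A = (\<Sum>e\<le>j. \<Sum>ls\<in>excess_indices r (j - e). f ((Suc c + e) # ls))"
proof -
  have "(\<Sum>e\<le>j. \<Sum>ls\<in>excess_indices r (j - e). f ((Suc c + e) # ls)) =
      (\<Sum>(e, ls)\<in>(SIGMA e:{..j}. excess_indices r (j - e)). f ((Suc c + e) # ls))"
    by (rule sum.Sigma) (auto simp: finite_excess_indices)
  also have "\<dots> = sum f A"
  proof (rule sum.reindex_bij_witness[of _ "\<lambda>ls. (hd ls - Suc c, tl ls)" "\<lambda>(e, ls). (Suc c + e) # ls"], goal_cases)
    case (4 y)
    then obtain l ls where y: "y = l # ls" "l \<ge> Suc c" "length ls = r" "\<forall>k\<in>set ls. k \<ge> 1"
      "l + sum_list ls = Suc c + r + j" by (auto simp: assms)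
    then show ?case using length_le_sum_list[of ls] by (auto simp: excess_indices_def)
  qed (auto simp: assms excess_indices_def)
  finally show ?thesis ..
qed

definition tmzv_total :: "nat \<Rightarrow> nat \<Rightarrow> nat \<Rightarrow> real" where
  "tmzv_total r j N = (\<Sum>ls\<in>excess_indices r j. tmzv ls N)"

text \<open>The contribution to the total of depth \<open>r + 1\<close> in which the largest summation variable is \<open>N\<close>.\<close>
definition tmzv_weighted :: "nat \<Rightarrow> nat \<Rightarrow> nat \<Rightarrow> real" where
  "tmzv_weighted r j N = (\<Sum>e\<le>j. tmzv_total r (j - e) N / real N ^ Suc e)"

lemma tmzv_weighted_nonneg: "tmzv_weighted r j N \<ge> 0"
  by (auto simp: tmzv_weighted_def tmzv_total_def intro!: sum_nonneg divide_nonneg_nonneg tmzv_nonneg)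

lemma tmzv_total_0: "tmzv_total 0 j N = (if j = 0 then 1 else 0)"
  by (simp add: tmzv_total_def excess_indices_0)

lemma tmzv_total_Suc_Suc:
  "tmzv_total (Suc r) j (Suc N) = tmzv_total (Suc r) j N + tmzv_weighted r j N"
proof -
  have "excess_indices (Suc r) j = {l # ls | l ls. l \<ge> Suc 0 \<and> length ls = r \<and> (\<forall>k\<in>set ls. k \<ge> 1) \<and> l + sum_list ls = Suc 0 + r + j}"
    by (auto simp: excess_indices_def length_Suc_conv)
  note S = sum_Cons_excess_indices[OF this]
  show ?thesis
    unfolding tmzv_total_def S
    by (simp add: tmzv_weighted_def tmzv_total_def sum.distrib sum_divide_distrib)
qed

lemma tmzv_eq_0:
  assumes "\<forall>k\<in>set ls. k \<ge> 1" "N \<ge> 1" "length ls \<ge> N"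
  shows "tmzv ls N = 0"
  using assms
proof (induction ls arbitrary: N)
  case (Cons l ls)
  show ?case unfolding tmzv.simps
  proof (rule sum.neutral, rule ballI)
    fix k assume "k \<in> {..<N}"
    then show "tmzv ls k / real k ^ l = 0"
      using Cons by (cases "k = 0") (auto simp: power_0_left)
  qed
qed simp

lemma tmzv_total_eq_0: "N \<ge> 1 \<Longrightarrow> r \<ge> N \<Longrightarrow> tmzv_total r j N = 0"
  unfolding tmzv_total_def by (intro sum.neutral ballI tmzv_eq_0) (auto simp: excess_indices_def)

lemma tmzv_weighted_eq_0: "N \<ge> 1 \<Longrightarrow> r \<ge> N \<Longrightarrow> tmzv_weighted r j N = 0"
  by (simp add: tmzv_weighted_def tmzv_total_eq_0)

lemma tmzv_weighted_rec:
  assumes "N \<ge> 1"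
  shows "real N * tmzv_weighted r 0 N = tmzv_total r 0 N"
    and "real N * tmzv_weighted r (Suc j) N = tmzv_total r (Suc j) N + tmzv_weighted r j N"
  using assms by (simp_all add: tmzv_weighted_def sum_distrib_left distrib_left sum.atMost_Suc_shift del: sum.atMost_Suc)

definition total_poly :: "real \<Rightarrow> nat \<Rightarrow> nat \<Rightarrow> real" where
  "total_poly b j M = (\<Sum>r\<le>M. tmzv_total r j (Suc M) * b ^ r)"

definition weighted_poly :: "real \<Rightarrow> nat \<Rightarrow> nat \<Rightarrow> real" where
  "weighted_poly b j M = (\<Sum>r\<le>M. tmzv_weighted r j (Suc M) * b ^ r)"

lemma total_poly_Suc: "total_poly b j (Suc M) = total_poly b j M + b * weighted_poly b j M"
proof -
  have "total_poly b j (Suc M) = tmzv_total 0 j (Suc (Suc M)) + (\<Sum>r\<le>M. tmzv_total (Suc r) j (Suc (Suc M)) * b ^ Suc r)"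
    unfolding total_poly_def by (subst sum.atMost_Suc_shift) simp
  also have "\<dots> = (tmzv_total 0 j (Suc M) + (\<Sum>r\<le>M. tmzv_total (Suc r) j (Suc M) * b ^ Suc r)) + b * weighted_poly b j M"
    by (simp add: tmzv_total_Suc_Suc tmzv_total_0 weighted_poly_def sum_distrib_left algebra_simps sum.distrib)
  also have "tmzv_total 0 j (Suc M) + (\<Sum>r\<le>M. tmzv_total (Suc r) j (Suc M) * b ^ Suc r) =
      (\<Sum>r\<le>Suc M. tmzv_total r j (Suc M) * b ^ r)"
    by (subst sum.atMost_Suc_shift) simp
  also have "\<dots> = total_poly b j M"
    by (simp add: total_poly_def tmzv_total_eq_0)
  finally show ?thesis .
qed

lemma weighted_poly_rec:
  "real (Suc M) * weighted_poly b 0 M = total_poly b 0 M"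
  "real (Suc M) * weighted_poly b (Suc j) M = total_poly b (Suc j) M + weighted_poly b j M"
proof -
  have *: "real (Suc M) * weighted_poly b j M = (\<Sum>r\<le>M. real (Suc M) * tmzv_weighted r j (Suc M) * b ^ r)" for j
    by (simp only: weighted_poly_def sum_distrib_left mult.assoc)
  show "real (Suc M) * weighted_poly b 0 M = total_poly b 0 M"
    unfolding * by (subst tmzv_weighted_rec) (simp_all add: total_poly_def)
  show "real (Suc M) * weighted_poly b (Suc j) M = total_poly b (Suc j) M + weighted_poly b j M"
    unfolding * by (subst tmzv_weighted_rec)
      (simp_all add: total_poly_def weighted_poly_def sum.distrib distrib_right)
qed

text \<open>For \<open>q = j + 1\<close> this is a closed form of \<open>weighted_poly b j M\<close>: both are the coefficient of \<open>c\<^sup>j\<close> in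
  \<open>\<Prod>\<^bsub>1\<le>k\<le>M\<^esub> (k + b - c) / \<Prod>\<^bsub>1\<le>k\<le>M+1\<^esub> (k - c)\<close>, and the sum over \<open>i\<close> is the partial fraction
  decomposition of this function of \<open>c\<close>, with poles at \<open>c = i + 1\<close>.\<close>
definition rising_poly :: "real \<Rightarrow> nat \<Rightarrow> nat \<Rightarrow> real" where
  "rising_poly b q M = (\<Sum>i\<le>M. rising (1 - b) i * rising b (M - i) / real (Suc i) ^ q)"

lemma rising_poly_0: "rising_poly b 0 M = 1"
  by (simp add: rising_poly_def rising_convolution rising_one)

text \<open>The factors \<open>M + 1 - i\<close> are absorbed by the recursion of the binomial coefficients
  \<open>rising b (M + 1 - i)\<close>.\<close>
lemma rising_poly_rec:
  "real (Suc (Suc M)) * rising_poly b (Suc q) (Suc M) - rising_poly b q (Suc M) =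
   (real (Suc M) + b) * rising_poly b (Suc q) M - rising_poly b q M"
proof -
  have s: "x / real (Suc i) ^ q = real (Suc i) * (x / real (Suc i) ^ Suc q)" for x i
    by simp
  have "real (Suc (Suc M)) * rising_poly b (Suc q) (Suc M) - rising_poly b q (Suc M) =
    (\<Sum>i\<le>Suc M. (real (Suc M) - real i) * (rising (1 - b) i * rising b (Suc M - i) / real (Suc i) ^ Suc q))"
    unfolding rising_poly_def s sum_distrib_left sum_subtractf[symmetric]
  proof (intro sum.cong refl)
    fix i
    have "real (Suc (Suc M)) * z - real (Suc i) * z = (real (Suc M) - real i) * z" for z
      by (simp add: algebra_simps)
    then show "real (Suc (Suc M)) * (rising (1 - b) i * rising b (Suc M - i) / real (Suc i) ^ Suc q) -
      real (Suc i) * (rising (1 - b) i * rising b (Suc M - i) / real (Suc i) ^ Suc q) =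
      (real (Suc M) - real i) * (rising (1 - b) i * rising b (Suc M - i) / real (Suc i) ^ Suc q)" .
  qed
  also have "\<dots> = (\<Sum>i\<le>M. (real (Suc M) - real i) * (rising (1 - b) i * rising b (Suc M - i) / real (Suc i) ^ Suc q))"
    by simp
  also have "\<dots> = (\<Sum>i\<le>M. (real M - real i + b) * (rising (1 - b) i * rising b (M - i) / real (Suc i) ^ Suc q))"
  proof (intro sum.cong refl)
    fix i assume "i \<in> {..M}"
    then have i: "i \<le> M" by simp
    have "(real (Suc M) - real i) * rising b (Suc M - i) = (real M - real i + b) * rising b (M - i)"
      using i by (simp add: Suc_diff_le rising_Suc of_nat_diff) (simp add: field_simps)
    then have "(real (Suc M) - real i) * rising b (Suc M - i) * (rising (1 - b) i / real (Suc i) ^ Suc q) =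
       (real M - real i + b) * rising b (M - i) * (rising (1 - b) i / real (Suc i) ^ Suc q)"
      by simp
    then show "(real (Suc M) - real i) * (rising (1 - b) i * rising b (Suc M - i) / real (Suc i) ^ Suc q) =
       (real M - real i + b) * (rising (1 - b) i * rising b (M - i) / real (Suc i) ^ Suc q)"
      by (simp add: mult_ac)
  qed
  also have "\<dots> = (real (Suc M) + b) * rising_poly b (Suc q) M - rising_poly b q M"
    unfolding rising_poly_def s sum_distrib_left sum_subtractf[symmetric]
  proof (intro sum.cong refl)
    fix i
    have "(real M - real i + b) * z = (real (Suc M) + b) * z - real (Suc i) * z" for z
      by (simp add: algebra_simps)
    then show "(real M - real i + b) * (rising (1 - b) i * rising b (M - i) / real (Suc i) ^ Suc q) =
      (real (Suc M) + b) * (rising (1 - b) i * rising b (M - i) / real (Suc i) ^ Suc q) -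
      real (Suc i) * (rising (1 - b) i * rising b (M - i) / real (Suc i) ^ Suc q)" .
  qed
  finally show ?thesis .
qed

text \<open>Both sides satisfy the same recursion in \<open>M\<close> and in the excess \<open>j\<close>. It starts correctly at
  \<open>j = 0\<close> because \<open>rising_poly b 0 M = 1\<close> does not depend on \<open>M\<close>.\<close>
lemma weighted_poly_eq_rising_poly: "weighted_poly b j M = rising_poly b (Suc j) M"
proof (induction M arbitrary: j)
  case 0
  have "tmzv_weighted 0 j (Suc 0) = (\<Sum>e\<le>j. if e = j then 1 else 0)"
    unfolding tmzv_weighted_def tmzv_total_0 by (intro sum.cong) auto
  then show ?case by (simp add: weighted_poly_def rising_poly_def)
next
  case (Suc M)
  note hyp = Suc.IH
  have W: "real (Suc (Suc M)) * weighted_poly b (Suc j) (Suc M) - weighted_poly b j (Suc M) =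
     (real (Suc M) + b) * weighted_poly b (Suc j) M - weighted_poly b j M" for j
    using weighted_poly_rec(2)[of "Suc M" b j] weighted_poly_rec(2)[of M b j] total_poly_Suc[of b "Suc j" M]
    by (simp add: algebra_simps)
  show ?case
  proof (induction j)
    case 0
    have "real (Suc (Suc M)) * weighted_poly b 0 (Suc M) = (real (Suc M) + b) * weighted_poly b 0 M"
      using weighted_poly_rec(1)[of "Suc M" b] weighted_poly_rec(1)[of M b] total_poly_Suc[of b 0 M]
      by (simp add: algebra_simps)
    also have "\<dots> = real (Suc (Suc M)) * rising_poly b (Suc 0) (Suc M)"
      using rising_poly_rec[of M b 0] by (simp add: Suc.IH rising_poly_0)
    finally show ?case by simp
  next
    case (Suc j)
    have "real (Suc (Suc M)) * weighted_poly b (Suc j) (Suc M) = real (Suc (Suc M)) * rising_poly b (Suc (Suc j)) (Suc M)"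
      using W[of j] rising_poly_rec[of M b "Suc j"] unfolding Suc.IH hyp by linarith
    then show ?case by simp
  qed
qed

lemma rising_poly_1:
  assumes "b \<noteq> 0"
  shows "rising_poly b 1 M = rising b (Suc M) / b"
proof (induction M)
  case 0
  then show ?case using assms by (simp add: rising_poly_def rising_Suc)
next
  case (Suc M)
  have "real (Suc (Suc M)) * rising_poly b 1 (Suc M) = (real (Suc M) + b) * rising_poly b 1 M"
    using rising_poly_rec[of M b 0] by (simp add: rising_poly_0)
  also have "\<dots> = (real (Suc M) + b) * (rising b (Suc M) / b)" by (simp only: Suc.IH)
  also have "\<dots> = real (Suc (Suc M)) * (rising b (Suc (Suc M)) / b)"
    by (subst rising_Suc[of b "Suc M"]) (simp add: mult_ac add_ac)
  finally show ?case by (metis mult_cancel_left of_nat_eq_0_iff nat.distinct(1))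
qed

lemma rising_poly_nonneg: "0 \<le> b \<Longrightarrow> b \<le> 1 \<Longrightarrow> rising_poly b q M \<ge> 0"
  unfolding rising_poly_def by (intro sum_nonneg divide_nonneg_nonneg mult_nonneg_nonneg rising_nonneg) auto

lemma rising_poly_le:
  assumes "0 \<le> b" "b \<le> 1"
  shows "rising_poly b (Suc j) M \<le> rising_poly b 1 M"
  unfolding rising_poly_def using assms
  by (intro sum_mono divide_left_mono mult_nonneg_nonneg rising_nonneg)
     (auto intro: power_increasing[of 1 "Suc j", simplified])

text \<open>The restricted sum with the first entry at least \<open>m + 2\<close>, of depth \<open>n + 1\<close> and total excess \<open>p\<close>. The
  shifts let all three parameters start at \<open>0\<close>, as exponents of a power series do.\<close>
definition restricted_sum :: "nat \<Rightarrow> nat \<Rightarrow> nat \<Rightarrow> real" where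
  "restricted_sum m n p = (\<Sum>ls\<in>sum_indices (m + n + p + 2) (m + 1) (n + 1). mzv ls)"

lemma restricted_sum_sums:
  "(\<lambda>M. tmzv_weighted n p (Suc M) / real (Suc M) ^ Suc m) sums restricted_sum m n p"
proof -
  have S: "sum_indices (m + n + p + 2) (m + 1) (n + 1) = {l # ls | l ls. l \<ge> Suc (Suc m) \<and> length ls = n \<and>
      (\<forall>k\<in>set ls. k \<ge> 1) \<and> l + sum_list ls = Suc (Suc m) + n + p}"
    by (auto simp: sum_indices_def length_Suc_conv)
  have eq: "restricted_sum m n p = (\<Sum>e\<le>p. \<Sum>ls\<in>excess_indices n (p - e). mzv ((Suc (Suc m) + e) # ls))"
    unfolding restricted_sum_def by (rule sum_Cons_excess_indices[OF S])
  have "(\<lambda>N. \<Sum>e\<le>p. \<Sum>ls\<in>excess_indices n (p - e). tmzv ls N / real N ^ (Suc (Suc m) + e)) sums restricted_sum m n p"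
    unfolding eq by (intro sums_sum mzv_sums) (auto simp: admissible_Cons_iff excess_indices_def)
  moreover have "(\<Sum>e\<le>p. \<Sum>ls\<in>excess_indices n (p - e). tmzv ls N / real N ^ (Suc (Suc m) + e)) =
      tmzv_weighted n p N / real N ^ Suc m" for N
    unfolding tmzv_weighted_def tmzv_total_def sum_divide_distrib
    by (intro sum.cong refl) (simp add: power_add mult_ac)
  ultimately have "(\<lambda>N. tmzv_weighted n p N / real N ^ Suc m) sums restricted_sum m n p" by simp
  then show ?thesis using sums_Suc_iff[of "\<lambda>N. tmzv_weighted n p N / real N ^ Suc m"] by simp
qed

section \<open>Symmetry of the restricted sums\<close>

lemma rising_mult_Beta:
  fixes a b :: real
  assumes "a < 1" "b < 1"
  shows "rising (1 - b) i * Beta (real i + 1 - a) (1 - b) =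
    Gamma (real i + 1 - a) * Gamma (real i + 1 - b) / (fact i * Gamma (real i + 2 - a - b))"
proof -
  have "pochhammer (1 - b) i = Gamma (1 - b + real i) / Gamma (1 - b)"
    using assms by (intro pochhammer_Gamma) (auto elim!: nonpos_Ints_cases)
  moreover have "Gamma (1 - b) \<noteq> 0" using Gamma_real_pos[of "1 - b"] assms(2) by linarith
  ultimately show ?thesis
    by (simp add: rising_def Beta_def add_ac) (simp add: algebra_simps)
qed

text \<open>The generating function \<open>\<Sum>\<^bsub>m,n\<^esub> restricted_sum m n p a\<^sup>m b\<^sup>n\<close> with the summations over \<open>m\<close> and \<open>n\<close>
  carried out inside the sum over the largest summation variable \<open>M + 1\<close>.\<close>
definition restricted_gen :: "nat \<Rightarrow> real \<Rightarrow> real \<Rightarrow> real" where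
  "restricted_gen p a b = (\<Sum>M. rising_poly b (Suc p) M / (real (Suc M) - a))"

lemma restricted_gen_has_sum:
  assumes "0 < a" "a < 1" "0 < b" "b < 1"
  shows "((\<lambda>M. rising_poly b (Suc p) M / (real (Suc M) - a)) has_sum restricted_gen p a b) UNIV"
proof -
  have "summable (\<lambda>M. rising b M / (real M + (1 - a)) / b)"
    using beta_series[of "1 - a" b] assms by (intro summable_divide) (auto simp: sums_iff)
  then have "summable (\<lambda>M. rising_poly b (Suc p) M / (real (Suc M) - a))"
  proof (rule summable_comparison_test'[of _ 0])
    fix M :: nat
    have "rising_poly b (Suc p) M \<le> rising b M / b"
    proof -
      have "rising_poly b (Suc p) M \<le> rising_poly b 1 M" using assms by (intro rising_poly_le) auto
      also have "\<dots> = rising b (Suc M) / b" using assms by (intro rising_poly_1) auto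
      also have "\<dots> \<le> rising b M / b" using assms by (intro divide_right_mono rising_antimono) auto
      finally show ?thesis .
    qed
    then have "rising_poly b (Suc p) M / (real (Suc M) - a) \<le> rising b M / b / (real (Suc M) - a)"
      using assms by (intro divide_right_mono) auto
    then show "norm (rising_poly b (Suc p) M / (real (Suc M) - a)) \<le> rising b M / (real M + (1 - a)) / b"
      using assms by (simp add: rising_poly_nonneg algebra_simps)
  qed
  then show ?thesis
    unfolding restricted_gen_def using assms
    by (intro sums_nonneg_imp_has_sum summable_sums) (auto intro!: divide_nonneg_nonneg rising_poly_nonneg)
qed

text \<open>Exchange the order of summation in the triangle \<open>i \<le> M\<close>; with \<open>j = M - i\<close> the sum over \<open>j\<close> is a
  beta series, and the resulting beta value combines with \<open>rising (1 - b) i\<close> to an expression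
  symmetric in \<open>a\<close> and \<open>b\<close>.\<close>
lemma restricted_gen_eq_Gamma_series:
  assumes "0 < a" "a < 1" "0 < b" "b < 1"
  shows "restricted_gen p a b = (\<Sum>i. Gamma (real i + 1 - a) * Gamma (real i + 1 - b) /
     (fact i * Gamma (real i + 2 - a - b)) / real (Suc i) ^ Suc p)"
proof -
  define t where "t = (\<lambda>i j. rising (1 - b) i * rising b j / real (Suc i) ^ Suc p / (real (Suc (i + j)) - a))"
  have t_nonneg: "t i j \<ge> 0" for i j
    unfolding t_def using assms by (intro divide_nonneg_nonneg mult_nonneg_nonneg rising_nonneg) auto
  have "((\<lambda>(M, i). t i (M - i)) has_sum restricted_gen p a b) (SIGMA M:UNIV. {..M})"
  proof (rule has_sum_Sigma_nonneg[OF _ restricted_gen_has_sum[OF assms]])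
    fix M :: nat
    have "(\<Sum>i\<le>M. t i (M - i)) = rising_poly b (Suc p) M / (real (Suc M) - a)"
      unfolding rising_poly_def sum_divide_distrib t_def by (intro sum.cong refl) simp
    then show "((\<lambda>i. case (M, i) of (M, i) \<Rightarrow> t i (M - i)) has_sum
       rising_poly b (Suc p) M / (real (Suc M) - a)) {..M}"
      by (simp add: has_sum_finite_iff)
  qed (use t_nonneg in auto)
  also have "?this \<longleftrightarrow> ((\<lambda>(i, j). t i j) has_sum restricted_gen p a b) (UNIV \<times> UNIV)"
    by (rule has_sum_reindex_bij_witness[of _ "\<lambda>(i, j). (i + j, i)" "\<lambda>(M, i). (i, M - i)"]) auto
  finally have sm: "((\<lambda>(i, j). t i j) has_sum restricted_gen p a b) (UNIV \<times> UNIV)" .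
  have "((\<lambda>j. t i j) has_sum (Gamma (real i + 1 - a) * Gamma (real i + 1 - b) /
     (fact i * Gamma (real i + 2 - a - b)) / real (Suc i) ^ Suc p)) UNIV" for i
  proof (rule sums_nonneg_imp_has_sum)
    have "(\<lambda>j. rising b j / (real j + (real i + 1 - a))) sums Beta (real i + 1 - a) (1 - b)"
      using assms by (intro beta_series) auto
    then have "(\<lambda>j. rising (1 - b) i / real (Suc i) ^ Suc p * (rising b j / (real j + (real i + 1 - a)))) sums
      (rising (1 - b) i / real (Suc i) ^ Suc p * Beta (real i + 1 - a) (1 - b))"
      by (rule sums_mult)
    moreover have "rising (1 - b) i / real (Suc i) ^ Suc p * (rising b j / (real j + (real i + 1 - a))) = t i j" for j
      by (simp add: t_def algebra_simps)
    moreover have "rising (1 - b) i / real (Suc i) ^ Suc p * Beta (real i + 1 - a) (1 - b) =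
      Gamma (real i + 1 - a) * Gamma (real i + 1 - b) /
     (fact i * Gamma (real i + 2 - a - b)) / real (Suc i) ^ Suc p"
      using rising_mult_Beta[of a b i] assms by simp
    ultimately show "t i sums (Gamma (real i + 1 - a) * Gamma (real i + 1 - b) /
     (fact i * Gamma (real i + 2 - a - b)) / real (Suc i) ^ Suc p)" by simp
  qed (rule t_nonneg)
  then have "((\<lambda>i. Gamma (real i + 1 - a) * Gamma (real i + 1 - b) /
     (fact i * Gamma (real i + 2 - a - b)) / real (Suc i) ^ Suc p) has_sum restricted_gen p a b) UNIV"
    by (intro has_sum_SigmaD[OF sm]) auto
  then show ?thesis using has_sum_imp_sums sums_unique by blast
qed

lemma restricted_gen_commute:
  assumes "0 < a" "a < 1" "0 < b" "b < 1"
  shows "restricted_gen p a b = restricted_gen p b a"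
  using assms by (simp add: restricted_gen_eq_Gamma_series mult.commute diff_diff_eq add.commute)

lemma restricted_sum_has_sum_gen:
  assumes ab: "0 < a" "a < 1" "0 < b" "b < 1"
  shows "((\<lambda>(m, n). restricted_sum m n p * a ^ m * b ^ n) has_sum restricted_gen p a b) UNIV"
proof -
  define t where "t = (\<lambda>M m n. tmzv_weighted n p (Suc M) / real (Suc M) ^ Suc m * a ^ m * b ^ n)"
  have t_nonneg: "t M m n \<ge> 0" for M m n
    unfolding t_def using ab by (intro divide_nonneg_nonneg mult_nonneg_nonneg tmzv_weighted_nonneg) auto
  have row: "((\<lambda>(m, n). t M m n) has_sum (rising_poly b (Suc p) M / (real (Suc M) - a))) (UNIV \<times> UNIV)" for M
  proof (rule has_sum_Sigma_nonneg)
    fix m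
    have "(\<Sum>n\<le>M. t M m n) = weighted_poly b p M * (a ^ m / real (Suc M) ^ Suc m)"
      unfolding t_def weighted_poly_def sum_distrib_right by (intro sum.cong refl) simp
    then have "((\<lambda>n. t M m n) has_sum (weighted_poly b p M * (a ^ m / real (Suc M) ^ Suc m))) {..M}"
      by (simp add: has_sum_finite_iff)
    then show "((\<lambda>n. case (m, n) of (m, n) \<Rightarrow> t M m n) has_sum (weighted_poly b p M * (a ^ m / real (Suc M) ^ Suc m))) UNIV"
      using has_sum_cong_neutral[of UNIV "{..M}" "t M m" "t M m"] by (auto simp: t_def tmzv_weighted_eq_0)
  next
    have "(\<lambda>m. (a / real (Suc M)) ^ m) sums (1 / (1 - a / real (Suc M)))"
      using ab by (intro geometric_sums) (auto simp: field_simps)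
    from sums_mult[OF this, of "weighted_poly b p M / real (Suc M)"]
    have "(\<lambda>m. weighted_poly b p M * (a ^ m / real (Suc M) ^ Suc m)) sums
       (weighted_poly b p M / real (Suc M) * (1 / (1 - a / real (Suc M))))"
      by (simp add: power_divide)
    also have "weighted_poly b p M / real (Suc M) * (1 / (1 - a / real (Suc M))) =
        rising_poly b (Suc p) M / (real (Suc M) - a)"
    proof -
      have "1 - a / real (Suc M) = (real (Suc M) - a) / real (Suc M)" by (simp add: diff_divide_distrib)
      then show ?thesis by (simp add: weighted_poly_eq_rising_poly del: of_nat_Suc)
    qed
    finally show "((\<lambda>m. weighted_poly b p M * (a ^ m / real (Suc M) ^ Suc m)) has_sum
      rising_poly b (Suc p) M / (real (Suc M) - a)) UNIV"
      using ab by (intro sums_nonneg_imp_has_sum)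
        (auto simp: weighted_poly_eq_rising_poly intro!: divide_nonneg_nonneg mult_nonneg_nonneg rising_poly_nonneg)
  qed (use t_nonneg in auto)
  have "((\<lambda>(M, mn). t M (fst mn) (snd mn)) has_sum restricted_gen p a b) (UNIV \<times> (UNIV \<times> UNIV))"
    by (rule has_sum_Sigma_nonneg[OF _ restricted_gen_has_sum[OF ab]])
       (use row t_nonneg in \<open>auto simp: case_prod_unfold\<close>)
  then have sm: "((\<lambda>(mn, M). t M (fst mn) (snd mn)) has_sum restricted_gen p a b) ((UNIV \<times> UNIV) \<times> UNIV)"
    by (subst (asm) has_sum_swap) simp
  have "((\<lambda>M. t M m n) has_sum (restricted_sum m n p * a ^ m * b ^ n)) UNIV" for m n
    using sums_mult[OF restricted_sum_sums[of n p m], of "a ^ m * b ^ n"] t_nonneg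
    by (intro sums_nonneg_imp_has_sum) (auto simp: t_def mult_ac)
  then have "((\<lambda>mn. restricted_sum (fst mn) (snd mn) p * a ^ fst mn * b ^ snd mn) has_sum restricted_gen p a b) (UNIV \<times> UNIV)"
    by (intro has_sum_SigmaD[OF sm]) auto
  then show ?thesis by (simp add: case_prod_unfold)
qed

text \<open>The generating function is symmetric and determines its coefficients.\<close>
lemma restricted_sum_commute: "restricted_sum m n p = restricted_sum n m p"
proof -
  have "(\<lambda>m n. restricted_sum m n p) = (\<lambda>m n. restricted_sum n m p)"
  proof (rule double_powser_unique[where S = "restricted_gen p"])
    fix a b :: real assume ab: "0 < a" "a < 1" "0 < b" "b < 1"
    show "((\<lambda>(m, n). restricted_sum m n p * a ^ m * b ^ n) has_sum restricted_gen p a b) UNIV"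
      by (rule restricted_sum_has_sum_gen[OF ab])
    have "((\<lambda>(m, n). restricted_sum m n p * b ^ m * a ^ n) has_sum restricted_gen p a b) (UNIV \<times> UNIV)"
      using restricted_sum_has_sum_gen[OF ab(3,4,1,2)] restricted_gen_commute[OF ab] by simp
    then have "((\<lambda>(n, m). restricted_sum m n p * b ^ m * a ^ n) has_sum restricted_gen p a b) (UNIV \<times> UNIV)"
      by (subst (asm) has_sum_swap) simp
    then show "((\<lambda>(m, n). restricted_sum n m p * a ^ m * b ^ n) has_sum restricted_gen p a b) UNIV"
      by (simp add: mult_ac)
  qed
  then show ?thesis by metis
qed

section \<open>The generating function at height one\<close>

text \<open>A positive limit of this decreasing sequence would make the beta series dominate a harmonic
  series.\<close>
lemma rising_tendsto_0:
  assumes "0 < b" "b < 1"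
  shows "rising b \<longlonglongrightarrow> 0"
proof -
  have dec: "decseq (rising b)" using assms by (intro decseq_SucI rising_antimono) auto
  obtain L where L: "rising b \<longlonglongrightarrow> L" "\<And>i. L \<le> rising b i"
    using decseq_convergent[OF dec, of 0] assms rising_nonneg[of b] by auto
  have "L \<ge> 0" using assms by (intro LIMSEQ_le_const[OF L(1)] exI[of _ 0]) (auto intro: rising_nonneg)
  moreover have "\<not> L > 0"
  proof
    assume "L > 0"
    have "summable (\<lambda>j. rising b j / (real j + 1))"
      using beta_series[of 1 b] assms by (auto simp: sums_iff)
    then have "summable (\<lambda>j. L / (real j + 1))"
      by (rule summable_comparison_test'[of _ 0]) (use L(2) \<open>L > 0\<close> in \<open>auto intro!: divide_right_mono\<close>)
    then have "summable (\<lambda>j. 1 / L * (L / (real j + 1)))" by (rule summable_mult)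
    then have "summable (\<lambda>j. inverse (real (Suc j)))" using \<open>L > 0\<close> by (simp add: field_simps)
    then show False using not_summable_harmonic[where 'a = real] summable_Suc_iff[of "\<lambda>j. inverse (real j)"] by simp
  qed
  ultimately show ?thesis using L(1) by simp
qed

text \<open>At excess zero, \<open>b\<close> times the generating function is the beta series with \<open>x = -a\<close> in place of
  \<open>x = 1 - a\<close>, without its first term \<open>-1/a\<close>. The two are contiguous, and their difference telescopes.\<close>
lemma restricted_gen_0_Gamma:
  assumes "0 < a" "0 < b" "a + b < 1"
  shows "1 - a * b * restricted_gen 0 a b = Gamma (1 - a) * Gamma (1 - b) / Gamma (1 - a - b)"
proof -
  have "(\<lambda>M. rising_poly b (Suc 0) M / (real (Suc M) - a)) sums restricted_gen 0 a b"
    using restricted_gen_has_sum[of a b 0] assms has_sum_imp_sums by auto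
  then have 1: "(\<lambda>M. a * b * (rising b (Suc M) / b / (real (Suc M) - a))) sums (a * b * restricted_gen 0 a b)"
    using rising_poly_1[of b] assms by (intro sums_mult) simp
  have 2: "(\<lambda>j. (1 - a - b) * (rising b j / (real j + (1 - a)))) sums ((1 - a - b) * Beta (1 - a) (1 - b))"
    using assms by (intro sums_mult beta_series) auto
  have "(\<lambda>j. rising b j - rising b (Suc j)) sums (rising b 0 - 0)"
    by (rule telescope_sums') (use rising_tendsto_0 assms in simp)
  moreover have "a * b * (rising b (Suc j) / b / (real (Suc j) - a)) +
     (1 - a - b) * (rising b j / (real j + (1 - a))) = rising b j - rising b (Suc j)" for j
  proof -
    have "real j + 1 - a > 0" using assms by simp
    moreover have "rising b (Suc j) * (real j + 1) = rising b j * (b + real j)"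
      by (simp add: rising_Suc add_ac)
    ultimately have "a * rising b (Suc j) + (1 - a - b) * rising b j =
        (rising b j - rising b (Suc j)) * (real j + 1 - a)" by algebra
    moreover have "a * b * (rising b (Suc j) / b / (real (Suc j) - a)) +
      (1 - a - b) * (rising b j / (real j + (1 - a))) =
      (a * rising b (Suc j) + (1 - a - b) * rising b j) / (real j + 1 - a)"
    proof -
      have d: "real (Suc j) - a = real j + 1 - a" "real j + (1 - a) = real j + 1 - a" by simp_all
      show ?thesis unfolding d using assms by (simp add: add_divide_distrib)
    qed
    ultimately show ?thesis using \<open>real j + 1 - a > 0\<close> by simp
  qed
  ultimately have "a * b * restricted_gen 0 a b + (1 - a - b) * Beta (1 - a) (1 - b) = 1"
    using sums_add[OF 1 2] sums_unique2 by simp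
  moreover have "(1 - a - b) * Beta (1 - a) (1 - b) = Gamma (1 - a) * Gamma (1 - b) / Gamma (1 - a - b)"
  proof -
    define s where "s = 1 - a - b"
    have "s > 0" using assms by (simp add: s_def)
    then have "Gamma (s + 1) = s * Gamma s"
      by (intro Gamma_plus1) (auto elim!: nonpos_Ints_cases)
    moreover have "1 - a + (1 - b) = s + 1" by (simp add: s_def)
    ultimately have "s * Beta (1 - a) (1 - b) = Gamma (1 - a) * Gamma (1 - b) / Gamma s"
      using \<open>s > 0\<close> unfolding Beta_def by (simp only:) simp
    then show ?thesis by (simp add: s_def)
  qed
  ultimately show ?thesis by simp
qed

text \<open>Coefficients of \<open>(\<psi>(1-a) - \<psi>(1-a-b)) / b\<close>.\<close>
definition zeta_coeff :: "nat \<Rightarrow> nat \<Rightarrow> real" where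
  "zeta_coeff q n = real ((q + n + 1) choose (n + 1)) * mzv [q + n + 2]"

lemma mzv_single_sums:
  assumes "l \<ge> 2"
  shows "(\<lambda>k. 1 / real (Suc k) ^ l) sums mzv [l]"
  using mzv_sums[of l "[]"] assms sums_Suc_iff[of "\<lambda>k. 1 / real k ^ l" "mzv [l]"]
  by (simp add: admissible_Cons_iff power_0_left)

lemma rising_of_nat: "rising (real (Suc q)) n = real ((q + n) choose n)"
  by (simp add: rising_def binomial_gbinomial gbinomial_pochhammer' add_ac)

text \<open>Expand the terms \<open>1/(k+1-a-b) - 1/(k+1-a)\<close> of the digamma series first in \<open>a\<close>, then in \<open>b\<close>;
  everything is nonnegative.\<close>
lemma digamma_diff_has_sum:
  assumes ab: "0 < a" "0 < b" "a + b < 1"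
  shows "((\<lambda>(q, n). zeta_coeff q n * a ^ q * b ^ n) has_sum
     ((Digamma (1 - a) - Digamma (1 - a - b)) / b)) UNIV"
proof -
  define t where "t = (\<lambda>k q n. rising (real (Suc q)) (Suc n) * a ^ q * b ^ n / real (Suc k) ^ (q + n + 2))"
  have t_nonneg: "t k q n \<ge> 0" for k q n
    unfolding t_def using ab by (intro divide_nonneg_nonneg mult_nonneg_nonneg rising_nonneg) auto
  define r where "r = (\<lambda>k q. (1 / (real (Suc k) - b) ^ Suc q - 1 / real (Suc k) ^ Suc q) * a ^ q / b)"
  have sn: "(\<lambda>n. t k q n) sums r k q" for k q
  proof -
    define x where "x = b / real (Suc k)"
    have x: "0 < x" "x < 1" using ab by (auto simp: x_def field_simps)
    have "(\<lambda>n. rising (real (Suc q)) n * x ^ n) sums (1 - x) powr (- real (Suc q))"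
      using rising_power_series[of x "real (Suc q)"] x by simp
    then have "(\<lambda>n. rising (real (Suc q)) (Suc n) * x ^ Suc n) sums ((1 - x) powr (- real (Suc q)) - 1)"
      by (subst sums_Suc_iff) simp
    from sums_mult[OF this, of "a ^ q / b / real (Suc k) ^ Suc q"]
    have "(\<lambda>n. a ^ q / b / real (Suc k) ^ Suc q * (rising (real (Suc q)) (Suc n) * x ^ Suc n)) sums
      (a ^ q / b / real (Suc k) ^ Suc q * ((1 - x) powr (- real (Suc q)) - 1))" .
    moreover have "a ^ q / b / real (Suc k) ^ Suc q * (rising (real (Suc q)) (Suc n) * x ^ Suc n) = t k q n" for n
      using ab by (simp add: t_def x_def power_divide power_add mult_ac)
    moreover have "(1 - x) powr (- real (Suc q)) = 1 / (1 - x) ^ Suc q"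
      using x by (simp add: powr_minus powr_realpow inverse_eq_divide del: of_nat_Suc power_Suc)
    moreover have "(1 - x) ^ Suc q = (real (Suc k) - b) ^ Suc q / real (Suc k) ^ Suc q"
      by (simp only: x_def power_divide[symmetric] diff_divide_distrib) simp
    ultimately show ?thesis
      by (simp add: r_def right_diff_distrib left_diff_distrib diff_divide_distrib mult_ac del: power_Suc of_nat_Suc)
  qed
  define s where "s = (\<lambda>k. (1 / (real (Suc k) - b - a) - 1 / (real (Suc k) - a)) / b)"
  have geo: "(\<lambda>q. 1 / c ^ Suc q * a ^ q) sums (1 / (c - a))" if "c > a" for c
  proof -
    have "(\<lambda>q. (a / c) ^ q) sums (1 / (1 - a / c))"
      using ab that by (intro geometric_sums) (auto simp: field_simps)
    from sums_mult[OF this, of "1 / c"] show ?thesis using ab that by (simp add: field_simps power_divide)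
  qed
  have sq: "(\<lambda>q. r k q) sums s k" for k
    using sums_divide[OF sums_diff[OF geo[of "real (Suc k) - b"] geo[of "real (Suc k)"]], of b] ab
    by (simp add: r_def s_def left_diff_distrib)
  have D: "(\<lambda>k. inverse (real (Suc k)) - inverse (z + real k)) sums (Digamma z + euler_mascheroni)" if "z > 0" for z :: real
    using summable_Digamma[of z] that by (simp add: Digamma_def summable_sums del: of_nat_Suc)
  have sk: "s sums ((Digamma (1 - a) - Digamma (1 - a - b)) / b)"
    using sums_divide[OF sums_diff[OF D[of "1 - a"] D[of "1 - a - b"]], of b] ab
    by (simp add: s_def inverse_eq_divide algebra_simps)
  have r_nonneg: "r k q \<ge> 0" for k q by (rule sums_le[OF _ sums_zero sn]) (rule t_nonneg)
  have s_nonneg: "s k \<ge> 0" for k by (rule sums_le[OF _ sums_zero sq]) (rule r_nonneg)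
  have row: "((\<lambda>(q, n). t k q n) has_sum s k) (UNIV \<times> UNIV)" for k
    by (rule has_sum_Sigma_nonneg[where g = "r k"])
       (use sn sq t_nonneg r_nonneg in \<open>auto intro!: sums_nonneg_imp_has_sum\<close>)
  have "((\<lambda>(k, qn). t k (fst qn) (snd qn)) has_sum ((Digamma (1 - a) - Digamma (1 - a - b)) / b)) (UNIV \<times> (UNIV \<times> UNIV))"
  proof (rule has_sum_Sigma_nonneg)
    show "(s has_sum ((Digamma (1 - a) - Digamma (1 - a - b)) / b)) UNIV"
      by (rule sums_nonneg_imp_has_sum[OF sk s_nonneg])
    show "((\<lambda>qn. case (k, qn) of (k, qn) \<Rightarrow> t k (fst qn) (snd qn)) has_sum s k) (UNIV \<times> UNIV)" for k
      using row[of k] by (simp add: case_prod_unfold)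
  qed (use t_nonneg in auto)
  then have sm: "((\<lambda>(qn, k). t k (fst qn) (snd qn)) has_sum ((Digamma (1 - a) - Digamma (1 - a - b)) / b)) ((UNIV \<times> UNIV) \<times> UNIV)"
    by (subst (asm) has_sum_swap) simp
  have "((\<lambda>k. t k q n) has_sum (zeta_coeff q n * a ^ q * b ^ n)) UNIV" for q n
    using sums_mult[OF mzv_single_sums[of "q + n + 2"], of "rising (real (Suc q)) (Suc n) * a ^ q * b ^ n"] t_nonneg
    by (intro sums_nonneg_imp_has_sum)
       (auto simp: t_def zeta_coeff_def rising_of_nat mult_ac simp del: of_nat_Suc binomial_Suc_Suc)
  then have "((\<lambda>qn. zeta_coeff (fst qn) (snd qn) * a ^ fst qn * b ^ snd qn) has_sum ((Digamma (1 - a) - Digamma (1 - a - b)) / b)) (UNIV \<times> UNIV)"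
    by (intro has_sum_SigmaD[OF sm]) auto
  then show ?thesis by (simp add: case_prod_unfold)
qed

section \<open>The recursion for height one\<close>

lemma fps_sum_conv_radius_eval:
  fixes f :: "nat \<Rightarrow> real fps"
  assumes "\<And>i. i < m \<Longrightarrow> fps_conv_radius (f i) \<ge> ereal e"
  shows "fps_conv_radius (\<Sum>i<m. f i) \<ge> ereal e \<and>
    (0 < x \<longrightarrow> x < e \<longrightarrow> eval_fps (\<Sum>i<m. f i) x = (\<Sum>i<m. eval_fps (f i) x))"
  using assms
proof (induction m)
  case (Suc m)
  have IH: "fps_conv_radius (\<Sum>i<m. f i) \<ge> ereal e"
    "0 < x \<longrightarrow> x < e \<longrightarrow> eval_fps (\<Sum>i<m. f i) x = (\<Sum>i<m. eval_fps (f i) x)"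
    using Suc by auto
  have fm: "fps_conv_radius (f m) \<ge> ereal e" using Suc.prems by simp
  have "fps_conv_radius ((\<Sum>i<m. f i) + f m) \<ge> ereal e"
    using fps_conv_radius_add[of "\<Sum>i<m. f i" "f m"] IH(1) fm
    by (meson min.boundedI order.trans)
  moreover have "eval_fps ((\<Sum>i<m. f i) + f m) x = (\<Sum>i<m. eval_fps (f i) x) + eval_fps (f m) x"
    if x: "0 < x" "x < e"
  proof -
    have "ereal (norm x) < ereal e" using x by simp
    then have "ereal (norm x) < fps_conv_radius (\<Sum>i<m. f i)" "ereal (norm x) < fps_conv_radius (f m)"
      using IH(1) fm by (blast intro: less_le_trans)+
    then show ?thesis using IH(2) x by (simp add: eval_fps_add)
  qed
  ultimately show ?case by simp
qed simp

lemma fps_conv_radius_mult_ge: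
  fixes f g :: "real fps"
  assumes "fps_conv_radius f \<ge> e" "fps_conv_radius g \<ge> e"
  shows "fps_conv_radius (f * g) \<ge> e"
  using fps_conv_radius_mult[of f g] assms by (meson min.boundedI order.trans)

lemma fps_conv_radius_diff_ge:
  fixes f g :: "real fps"
  assumes "fps_conv_radius f \<ge> e" "fps_conv_radius g \<ge> e"
  shows "fps_conv_radius (f - g) \<ge> e"
  using fps_conv_radius_diff[of f g] assms by (meson min.boundedI order.trans)

definition height_one_row :: "nat \<Rightarrow> real \<Rightarrow> real" where
  "height_one_row m b = (\<Sum>n. restricted_sum m n 0 * b ^ n)"

definition zeta_row :: "nat \<Rightarrow> real \<Rightarrow> real" where
  "zeta_row q b = (\<Sum>n. zeta_coeff q n * b ^ n)"

text \<open>For fixed \<open>b\<close>, compare coefficients of \<open>a\<^sup>m\<close> in \<open>\<partial>B/\<partial>a = (1 - B) (\<psi>(1-a) - \<psi>(1-a-b))\<close>, where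
  \<open>B = a b restricted_gen 0 a b\<close>.\<close>
lemma height_one_row_rec:
  assumes b: "0 < b" "b < 1"
  shows "real (Suc m) * height_one_row m b =
    zeta_row m b - b * (\<Sum>i<m. height_one_row i b * zeta_row (m - 1 - i) b)"
proof -
  \<comment> \<open>\<open>A\<close> is \<open>B\<close> as a power series in \<open>a\<close>; it has no constant term because \<open>B\<close> has the factor \<open>a\<close>.\<close>
  define A where "A = Abs_fps (\<lambda>m. case m of 0 \<Rightarrow> 0 | Suc i \<Rightarrow> b * height_one_row i b)"
  define R where "R = Abs_fps (\<lambda>q. b * zeta_row q b)"
  have A_sums: "(\<lambda>m. fps_nth A m * a ^ m) sums (a * b * restricted_gen 0 a b)" if a: "0 < a" "a < 1" for a
  proof -
    have "(\<lambda>m. height_one_row m b * a ^ m) sums restricted_gen 0 a b"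
      unfolding height_one_row_def
      by (rule double_powser_rows(2)[OF restricted_sum_has_sum_gen]) (use a b in auto)
    from sums_mult[OF this, of "a * b"]
    have "(\<lambda>m. fps_nth A (Suc m) * a ^ Suc m) sums (a * b * restricted_gen 0 a b)"
      by (simp add: A_def mult_ac)
    then show ?thesis by (subst (asm) sums_Suc_iff) (simp add: A_def)
  qed
  have R_sums: "(\<lambda>m. fps_nth R m * a ^ m) sums (Digamma (1 - a) - Digamma (1 - a - b))"
    if a: "0 < a" "a < 1 - b" for a
  proof -
    have "(\<lambda>m. zeta_row m b * a ^ m) sums ((Digamma (1 - a) - Digamma (1 - a - b)) / b)"
      unfolding zeta_row_def
      by (rule double_powser_rows(2)[OF digamma_diff_has_sum]) (use a b in auto)
    from sums_mult[OF this, of b] show ?thesis using b by (simp add: R_def mult_ac)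
  qed
  have radA: "fps_conv_radius A \<ge> ereal (1 - b)"
    by (rule fps_conv_radius_ge_right) (use A_sums b in \<open>auto simp: sums_iff\<close>)
  have radR: "fps_conv_radius R \<ge> ereal (1 - b)"
    by (rule fps_conv_radius_ge_right) (use R_sums in \<open>auto simp: sums_iff\<close>)
  define h where "h = (\<lambda>a. Gamma (1 - a) * Gamma (1 - b) / Gamma (1 - a - b))"
  have evalA: "eval_fps A a = 1 - h a" if "0 < a" "a < 1 - b" for a
    using A_sums[of a] restricted_gen_0_Gamma[of a b] that b by (simp add: eval_fps_def sums_iff h_def)
  have evalR: "eval_fps R a = Digamma (1 - a) - Digamma (1 - a - b)" if "0 < a" "a < 1 - b" for a
    using R_sums[of a] that by (simp add: eval_fps_def sums_iff)
  \<comment> \<open>The logarithmic derivative of \<open>h = 1 - B\<close>; for \<open>0 < a < 1 - b\<close> all arguments of \<open>\<Gamma>\<close> and \<open>\<psi>\<close> are positive.\<close>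
  have eq: "fps_deriv A = (1 - A) * R"
  proof (rule fps_eqI_right[of "1 - b"])
    show "fps_conv_radius (fps_deriv A) \<ge> ereal (1 - b)"
      using fps_conv_radius_deriv[of A] radA by (rule order.trans[rotated])
    show "fps_conv_radius ((1 - A) * R) \<ge> ereal (1 - b)"
      by (intro fps_conv_radius_mult_ge fps_conv_radius_diff_ge radA radR) simp
    fix a :: real assume a: "0 < a" "a < 1 - b"
    have "ereal (norm a) < ereal (1 - b)" using a by simp
    then have na: "ereal (norm a) < fps_conv_radius A" "ereal (norm a) < fps_conv_radius R"
      using radA radR by (blast intro: less_le_trans)+
    have pos: "1 - a > 0" "1 - a - b > 0" using a b by simp_all
    then have nonpole: "1 - a \<notin> \<int>\<^sub>\<le>\<^sub>0" "1 - a - b \<notin> \<int>\<^sub>\<le>\<^sub>0" by (auto elim!: nonpos_Ints_cases)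
    have G: "Gamma (1 - a - b) \<noteq> 0" using Gamma_real_pos[OF pos(2)] by linarith
    have "(h has_field_derivative (h a * (Digamma (1 - a - b) - Digamma (1 - a)))) (at a)"
      unfolding h_def using nonpole G
      by (auto intro!: derivative_eq_intros) (simp add: divide_simps algebra_simps)
    then have "((\<lambda>a. 1 - h a) has_field_derivative (h a * (Digamma (1 - a) - Digamma (1 - a - b)))) (at a)"
      by (auto intro!: derivative_eq_intros simp: algebra_simps)
    then have "(eval_fps A has_field_derivative (h a * (Digamma (1 - a) - Digamma (1 - a - b)))) (at a)"
      by (rule has_field_derivative_transform_within_open[of _ _ _ "{0<..<1 - b}"]) (use a evalA in auto)
    moreover have "(eval_fps A has_field_derivative eval_fps (fps_deriv A) a) (at a)"
      by (rule has_field_derivative_eval_fps[OF na(1)])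
    ultimately have "eval_fps (fps_deriv A) a = h a * (Digamma (1 - a) - Digamma (1 - a - b))"
      by (rule DERIV_unique[rotated])
    also have "\<dots> = eval_fps ((1 - A) * R) a"
    proof -
      have "eval_fps (1 - A) a = h a" using na evalA[OF a] by (simp add: eval_fps_diff)
      moreover have "ereal (norm a) < fps_conv_radius (1 - A)"
        using fps_conv_radius_diff[of 1 A] na(1) by simp
      ultimately show ?thesis using na evalR[OF a] by (simp add: eval_fps_mult)
    qed
    finally show "eval_fps (fps_deriv A) a = eval_fps ((1 - A) * R) a" .
  qed (use b in simp)
  have "fps_nth (A * R) m = b * (b * (\<Sum>i<m. height_one_row i b * zeta_row (m - 1 - i) b))"
  proof (cases m)
    case 0
    then show ?thesis by (simp add: fps_mult_nth A_def)
  next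
    case (Suc m')
    have "fps_nth (A * R) m = (\<Sum>i\<le>Suc m'. fps_nth A i * fps_nth R (Suc m' - i))"
      by (simp add: fps_mult_nth Suc atLeast0AtMost)
    also have "\<dots> = (\<Sum>i<m. b * (b * (height_one_row i b * zeta_row (m - 1 - i) b)))"
      by (subst sum.atMost_Suc_shift) (simp add: A_def R_def Suc lessThan_Suc_atMost mult_ac)
    finally show ?thesis by (simp add: sum_distrib_left)
  qed
  moreover have "fps_nth (fps_deriv A) m = fps_nth R m - fps_nth (A * R) m"
    unfolding eq by (simp add: left_diff_distrib)
  ultimately have "b * (real (Suc m) * height_one_row m b) =
      b * (zeta_row m b - b * (\<Sum>i<m. height_one_row i b * zeta_row (m - 1 - i) b))"
    by (simp add: A_def R_def algebra_simps)
  then show ?thesis using b by simp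
qed

text \<open>The same comparison for the powers of \<open>b\<close>. The right-hand side consists of rational multiples of
  a single zeta value and of products of two multiple zeta values.\<close>
lemma height_one_rec:
  "real (Suc m) * restricted_sum m n 0 = zeta_coeff m n -
     (\<Sum>i<m. \<Sum>j<n. restricted_sum i j 0 * zeta_coeff (m - 1 - i) (n - 1 - j))"
proof -
  define U where "U = (\<lambda>i. Abs_fps (\<lambda>n. restricted_sum i n 0))"
  define Z where "Z = (\<lambda>q. Abs_fps (\<lambda>n. zeta_coeff q n))"
  have radU: "fps_conv_radius (U i) \<ge> ereal 1" for i
  proof (rule fps_conv_radius_ge_right)
    fix b :: real assume "0 < b" "b < 1"
    then show "summable (\<lambda>n. fps_nth (U i) n * b ^ n)"
      using double_powser_rows(1)[OF restricted_sum_has_sum_gen[of "1/2" b 0], of i] by (simp add: U_def)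
  qed
  have radZ: "fps_conv_radius (Z q) \<ge> ereal 1" for q
  proof (rule fps_conv_radius_ge_right)
    fix b :: real assume "0 < b" "b < 1"
    moreover from this have "(1 - b) / 2 + b < 1" by (simp add: field_simps)
    ultimately show "summable (\<lambda>n. fps_nth (Z q) n * b ^ n)"
      using double_powser_rows(1)[OF digamma_diff_has_sum[of "(1 - b) / 2" b], of q] by (simp add: Z_def)
  qed
  define S where "S = (\<Sum>i<m. U i * Z (m - 1 - i))"
  have radS: "fps_conv_radius S \<ge> ereal 1"
    unfolding S_def by (intro fps_sum_conv_radius_eval[THEN conjunct1] fps_conv_radius_mult_ge radU radZ)
  have "fps_const (real (Suc m)) * U m = Z m - fps_X * S"
  proof (rule fps_eqI_right[of 1])
    show "fps_conv_radius (fps_const (real (Suc m)) * U m) \<ge> ereal 1"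
      by (intro fps_conv_radius_mult_ge radU) simp
    show "fps_conv_radius (Z m - fps_X * S) \<ge> ereal 1"
      by (intro fps_conv_radius_mult_ge fps_conv_radius_diff_ge radZ radS) simp
    fix b :: real assume b: "0 < b" "b < 1"
    have radXS: "fps_conv_radius (fps_X * S) \<ge> ereal 1"
      by (intro fps_conv_radius_mult_ge radS) simp
    have lt: "ereal (norm b) < ereal 1" using b by simp
    note nb = less_le_trans[OF lt radU] less_le_trans[OF lt radZ]
      less_le_trans[OF lt radS] less_le_trans[OF lt radXS]
    have ev: "eval_fps (U i) b = height_one_row i b" "eval_fps (Z i) b = zeta_row i b" for i
      by (simp_all add: eval_fps_def U_def Z_def height_one_row_def zeta_row_def)
    have "eval_fps S b = (\<Sum>i<m. eval_fps (U i * Z (m - 1 - i)) b)"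
      unfolding S_def using b
      by (intro fps_sum_conv_radius_eval[THEN conjunct2, rule_format, where e = 1] fps_conv_radius_mult_ge radU radZ)
    also have "\<dots> = (\<Sum>i<m. height_one_row i b * zeta_row (m - 1 - i) b)"
      using nb by (simp add: eval_fps_mult ev)
    finally have evS: "eval_fps S b = (\<Sum>i<m. height_one_row i b * zeta_row (m - 1 - i) b)" .
    show "eval_fps (fps_const (real (Suc m)) * U m) b = eval_fps (Z m - fps_X * S) b"
      using height_one_row_rec[OF b, of m] nb by (simp add: eval_fps_mult eval_fps_diff ev evS)
  qed simp
  then have "fps_nth (fps_const (real (Suc m)) * U m) n = fps_nth (Z m - fps_X * S) n" by simp
  moreover have "fps_nth (fps_X * S) n = (\<Sum>i<m. \<Sum>j<n. restricted_sum i j 0 * zeta_coeff (m - 1 - i) (n - 1 - j))"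
  proof (cases n)
    case (Suc n')
    have "fps_nth (fps_X * S) (Suc n') = fps_nth S n'" by simp
    also have "\<dots> = (\<Sum>i<m. \<Sum>j<Suc n'. restricted_sum i j 0 * zeta_coeff (m - 1 - i) (n' - j))"
      by (simp add: S_def fps_sum_nth fps_mult_nth U_def Z_def lessThan_Suc_atMost atLeast0AtMost)
    finally show ?thesis by (simp add: Suc)
  qed simp
  ultimately show ?thesis by (simp add: U_def Z_def del: of_nat_Suc)
qed

section \<open>Membership in the depth and product spaces\<close>

lemma rat_subspace_nat_mult: "rat_real.subspace V \<Longrightarrow> x \<in> V \<Longrightarrow> real k * x \<in> V"
  using rat_real.subspace_scale[of V x "of_nat k"] by simp

lemma subspace_product_space: "rat_real.subspace (mzv_product_space l)"
  by (simp add: mzv_product_space_def)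

lemma zeta_coeff_in_product_space: "zeta_coeff m n \<in> mzv_product_space (m + n + 2)"
  unfolding zeta_coeff_def
  by (intro rat_subspace_nat_mult subspace_product_space)
     (auto simp: mzv_product_space_def intro!: rat_real.span_base)

lemma height_one_in_product_space: "restricted_sum m n 0 \<in> mzv_product_space (m + n + 2)"
proof (rule rat_subspace_cancel_nat[OF subspace_product_space])
  show "real (Suc m) * restricted_sum m n 0 \<in> mzv_product_space (m + n + 2)"
    unfolding height_one_rec
  proof (intro rat_real.subspace_diff rat_real.subspace_sum subspace_product_space zeta_coeff_in_product_space)
    fix i j assume ij: "i \<in> {..<m}" "j \<in> {..<n}"
    define q r where "q = m - 1 - i" and "r = n - 1 - j"
    have "restricted_sum i j 0 * zeta_coeff q r = (\<Sum>ls\<in>sum_indices (i + j + 2) (i + 1) (j + 1).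
       real ((q + r + 1) choose (r + 1)) * (mzv ls * mzv [q + r + 2]))"
      unfolding restricted_sum_def zeta_coeff_def sum_distrib_right
      by (intro sum.cong) (simp_all add: mult_ac del: binomial_Suc_Suc)
    also have "\<dots> \<in> mzv_product_space (m + n + 2)"
      by (intro rat_real.subspace_sum rat_subspace_nat_mult subspace_product_space mzv_mult_in_product_space)
         (use ij in \<open>auto simp: sum_indices_def admissible_def q_def r_def\<close>)
    finally show "restricted_sum i j 0 * zeta_coeff (m - 1 - i) (n - 1 - j) \<in> mzv_product_space (m + n + 2)"
      by (simp add: q_def r_def)
  qed
qed simp

lemma sum_eq_restricted_sum:
  assumes "m \<ge> 1" "n \<ge> 1" "l \<ge> m + n"
  shows "(\<Sum>ls\<in>sum_indices l m n. mzv ls) = restricted_sum (m - 1) (n - 1) (l - m - n)"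
proof -
  have "m - 1 + (n - 1) + (l - m - n) + 2 = l" "m - 1 + 1 = m" "n - 1 + 1 = n" using assms by auto
  then show ?thesis unfolding restricted_sum_def by (simp only:)
qed

lemma sum_mzv_in_space:
  assumes "m \<ge> 1" "n \<ge> 1" "l \<ge> m + n"
  shows "(\<Sum>ls\<in>sum_indices l m n. mzv ls) \<in> mzv_depth_space l (n + 1) + mzv_product_space l"
proof (cases "l = m + n")
  case True
  then have "m - 1 + (n - 1) + 2 = l" "l - m - n = 0" using assms by auto
  then have "(\<Sum>ls\<in>sum_indices l m n. mzv ls) \<in> mzv_product_space l"
    using height_one_in_product_space[of "m - 1" "n - 1"] sum_eq_restricted_sum[OF assms] by (simp only:)
  then show ?thesis using product_space_subset by blast
qed (use assms sum_mzv_in_space_excess in auto)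

lemma depth_space_subset_less_space:
  assumes "d \<in> {1..<n}"
  shows "mzv_depth_space l d \<subseteq> mzv_depth_less_space l n"
proof
  fix x assume x: "x \<in> mzv_depth_space l d"
  have "x = (\<Sum>e\<in>{1..<n}. if e = d then x else 0)" using assms by simp
  moreover have "(\<Sum>e\<in>{1..<n}. if e = d then x else 0) \<in> mzv_depth_less_space l n"
    unfolding mzv_depth_less_space_def set_sum_alt[OF finite_atLeastLessThan]
    using x by (auto intro!: exI[of _ "\<lambda>e. if e = d then x else 0"] simp: mzv_depth_space_def rat_real.span_zero)
  ultimately show "x \<in> mzv_depth_less_space l n" by simp
qed

theorem corollary1p3:
  fixes l m n :: nat
  assumes "m \<ge> 1" and "n \<ge> 1" and "l \<ge> m + n" and "even l"
  shows "(\<forall>d\<in>{m, n}. cong_modulo (\<Sum>ls\<in>sum_indices l m n. mzv ls) 0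
             (mzv_depth_space l (d + 1) + mzv_product_space l)) \<and>
         (m + 1 < n \<longrightarrow> cong_modulo (\<Sum>ls\<in>sum_indices l m n. mzv ls) 0
             (mzv_depth_less_space l n + mzv_product_space l))"
proof -
  let ?S = "\<Sum>ls\<in>sum_indices l m n. mzv ls"
  have "l - m - n = l - n - m" by simp
  then have "?S = (\<Sum>ls\<in>sum_indices l n m. mzv ls)"
    using assms by (simp only: sum_eq_restricted_sum restricted_sum_commute[of "m - 1"] add.commute)
  then have m: "?S \<in> mzv_depth_space l (m + 1) + mzv_product_space l"
    using sum_mzv_in_space[of n m l] assms by simp
  have n: "?S \<in> mzv_depth_space l (n + 1) + mzv_product_space l"
    using sum_mzv_in_space[of m n l] assms by simp
  have "?S \<in> mzv_depth_less_space l n + mzv_product_space l" if "m + 1 < n"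
    using m depth_space_subset_less_space[of "m + 1" n l] that
      set_plus_mono2[of "mzv_depth_space l (m + 1)" "mzv_depth_less_space l n" "mzv_product_space l" "mzv_product_space l"]
    by auto
  with m n show ?thesis by (auto simp: cong_modulo_def)
qed

end
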